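(* Let $X$ be a homogeneous tree of degree $q+1$, $q\ge 2$, let $\alpha\in(0,2)$, and let $p_t(x)$ be the $\alpha$-stable kernel on $X$. For $0<A_1<A_2$ and $t>0$ let $R(t)=\{x\in X: A_1t^{2/\alpha}\le |x|\le A_2t^{2/\alpha}\}$. Then there exist constants $c_1$ and $c_2$ such that $$0<c_1<\sum_{x\in R(t)}p_t(x)<c_2<1\qquad\text{for all sufficiently large } t. \qquad ( * )$$ Conversely, for any given $c_1\in(0,1)$ there exist $A_1<A_2$ (positive) such that $( * )$ holds with this $c_1$ and some $c_2$; and for any given $c_2\in(0,1)$ there exist $A_1<A_2$ (positive) such that $( * )$ holds with this $c_2$ and some $c_1$.
   Context: $X$ is (the vertex set of) the homogeneous tree of degree $q+1$ with $q\ge 2$, with its graph distance $d$, counting measure and a fixed reference vertex $o$; $|x|=d(x,o)$. The nearest-neighbour Laplacian is $\Delta f(x)=f(x)-\frac1{q+1}\sum_{y\sim x}f(y)$, the heat semigroup is $e^{-t\Delta}$, and $h_t(x)=(e^{-t\Delta}\delta_o)(x)$ is its heat kernel. For $t>0$, $\eta_t$ is the function on $(0,\infty)$ determined by its Laplace transform $\int_0^\infty e^{-\lambda u}\eta_t(u)\,du=e^{-t\lambda^{\alpha/2}}$, $\lambda\ge0$. The $\alpha$-stable kernel is $p_t(x)=\int_0^\infty h_u(x)\eta_t(u)\,du$, the kernel of $e^{-t\Delta^{\alpha/2}}$. *)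

theory Defs
  imports "HOL-Analysis.Analysis"
begin

text \<open>
  A graph is given by its adjacency relation; the vertex set is the whole type. Walks of length
  \<open>n\<close> from \<open>x\<close> to \<open>y\<close> exist iff \<open>(adj ^^ n) x y\<close>.
\<close>

definition graph_cycle :: "('a \<Rightarrow> 'a \<Rightarrow> bool) \<Rightarrow> 'a list \<Rightarrow> bool" where
  "graph_cycle adj xs \<longleftrightarrow>
     3 \<le> length xs \<and> distinct xs \<and> successively adj xs \<and> adj (last xs) (hd xs)"

text \<open>
  The degree condition includes local finiteness, because \<open>card\<close> of an infinite set is \<open>0\<close>.
\<close>

definition homogeneous_tree :: "nat \<Rightarrow> ('a \<Rightarrow> 'a \<Rightarrow> bool) \<Rightarrow> bool" where
  "homogeneous_tree q adj \<longleftrightarrow>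
     (\<forall>x y. adj x y \<longrightarrow> adj y x) \<and> (\<forall>x. \<not> adj x x) \<and>
     (\<forall>x y. adj\<^sup>*\<^sup>* x y) \<and>
     (\<nexists>xs. graph_cycle adj xs) \<and>
     (\<forall>x. card {y. adj x y} = q + 1)"

definition graph_dist :: "('a \<Rightarrow> 'a \<Rightarrow> bool) \<Rightarrow> 'a \<Rightarrow> 'a \<Rightarrow> nat" where
  "graph_dist adj x y = (LEAST n. (adj ^^ n) x y)"

definition laplacian :: "nat \<Rightarrow> ('a \<Rightarrow> 'a \<Rightarrow> bool) \<Rightarrow> ('a \<Rightarrow> real) \<Rightarrow> 'a \<Rightarrow> real" where
  "laplacian q adj f x = f x - 1 / (real q + 1) * (\<Sum>y | adj x y. f y)"

text \<open>
  The exponential series of the bounded operator \<open>- t\<Delta>\<close>, evaluated pointwise. For bounded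
  \<open>f\<close> it converges absolutely, since \<open>\<bar>\<Delta>\<^sup>n f\<bar> \<le> 2\<^sup>n sup \<bar>f\<bar>\<close>.
\<close>

definition heat_semigroup ::
  "nat \<Rightarrow> ('a \<Rightarrow> 'a \<Rightarrow> bool) \<Rightarrow> real \<Rightarrow> ('a \<Rightarrow> real) \<Rightarrow> 'a \<Rightarrow> real" where
  "heat_semigroup q adj t f x = (\<Sum>n. (- t) ^ n / fact n * ((laplacian q adj ^^ n) f) x)"

definition heat_kernel ::
  "nat \<Rightarrow> ('a \<Rightarrow> 'a \<Rightarrow> bool) \<Rightarrow> 'a \<Rightarrow> real \<Rightarrow> 'a \<Rightarrow> real" where
  "heat_kernel q adj x0 t = heat_semigroup q adj t (\<lambda>x. if x = x0 then 1 else 0)"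

text \<open>
  The Laplace transform determines \<open>\<eta> t\<close> on \<open>(0,\<infinity>)\<close> only up to null sets, so the property is
  stated for an arbitrary version. Only the values on \<open>(0,\<infinity>)\<close> matter. Integrability is the
  convergence of the Laplace integral at \<open>l = 0\<close>, which implies it for all \<open>l \<ge> 0\<close>.
\<close>

definition stable_densities :: "real \<Rightarrow> (real \<Rightarrow> real \<Rightarrow> real) \<Rightarrow> bool" where
  "stable_densities \<alpha> \<eta> \<longleftrightarrow>
     (\<forall>t>0. set_integrable lborel {0<..} (\<eta> t) \<and>
        (\<forall>l\<ge>0. (LBINT u:{0<..}. exp (- l * u) * \<eta> t u) = exp (- t * l powr (\<alpha> / 2))))"

definition stable_kernel ::
  "nat \<Rightarrow> ('a \<Rightarrow> 'a \<Rightarrow> bool) \<Rightarrow> 'a \<Rightarrow> (real \<Rightarrow> real \<Rightarrow> real) \<Rightarrow> real \<Rightarrow> 'a \<Rightarrow> real" where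
  "stable_kernel q adj x0 \<eta> t x = (LBINT u:{0<..}. heat_kernel q adj x0 u x * \<eta> t u)"

definition critical_region ::
  "('a \<Rightarrow> 'a \<Rightarrow> bool) \<Rightarrow> 'a \<Rightarrow> real \<Rightarrow> real \<Rightarrow> real \<Rightarrow> real \<Rightarrow> 'a set" where
  "critical_region adj x0 \<alpha> A\<^sub>1 A\<^sub>2 t =
     {x. A\<^sub>1 * t powr (2 / \<alpha>) \<le> real (graph_dist adj x x0) \<and>
         real (graph_dist adj x x0) \<le> A\<^sub>2 * t powr (2 / \<alpha>)}"

definition mass_bounds ::
  "nat \<Rightarrow> ('a \<Rightarrow> 'a \<Rightarrow> bool) \<Rightarrow> 'a \<Rightarrow> real \<Rightarrow> (real \<Rightarrow> real \<Rightarrow> real) \<Rightarrow>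
   real \<Rightarrow> real \<Rightarrow> real \<Rightarrow> real \<Rightarrow> bool" where
  "mass_bounds q adj x0 \<alpha> \<eta> A\<^sub>1 A\<^sub>2 c\<^sub>1 c\<^sub>2 \<longleftrightarrow>
     (\<forall>\<^sub>F t in at_top.
        0 < c\<^sub>1 \<and>
        c\<^sub>1 < (\<Sum>x\<in>critical_region adj x0 \<alpha> A\<^sub>1 A\<^sub>2 t. stable_kernel q adj x0 \<eta> t x) \<and>
        (\<Sum>x\<in>critical_region adj x0 \<alpha> A\<^sub>1 A\<^sub>2 t. stable_kernel q adj x0 \<eta> t x) < c\<^sub>2 \<and>
        c\<^sub>2 < 1)"

end

theory Submission
  imports Defs "HOL-Probability.Probability_Measure"
begin

text \<open>
  Write \<open>\<beta> = \<alpha> / 2\<close> and \<open>s = t powr (1 / \<beta>)\<close>. The random walk on the tree has linear speed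
  \<open>\<gamma> = (q - 1) / (q + 1)\<close>, and an exponential Chebyshev bound with the functions
  \<open>r ^ \<bar>x\<bar>\<close> shows that the heat kernel at time \<open>u\<close> concentrates on \<open>\<bar>x\<bar> \<approx> \<gamma> u\<close>. By uniqueness of
  Laplace transforms \<open>\<eta> t u = \<eta> 1 (u / s) / s\<close> almost everywhere, so the mass of the region is the
  integral over \<open>v\<close>, against the law \<open>\<eta> 1\<close>, of the heat mass of the region at time \<open>s v\<close>; by dominated
  convergence it tends to the probability of \<open>(A\<^sub>1 / \<gamma>, A\<^sub>2 / \<gamma>)\<close> under that law.

  The law is a probability measure because \<open>exp (- l powr \<beta>)\<close> is completely monotone. If \<open>U\<close>, \<open>V\<close> are
  independent with this law and \<open>a powr \<beta> + b powr \<beta> = 1\<close>, then \<open>a U + b V\<close> has this law too, so the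
  support is closed under multiplication by \<open>a + b\<close>, hence by all of \<open>(0, 1]\<close>. Since the support
  is unbounded, every interval in \<open>(0, \<infinity>)\<close> has positive probability.
\<close>

section \<open>The heat kernel on a homogeneous tree\<close>

text \<open>If the new starting vertex already lies on the path, the path is cut back to it. The
  last conjunct is what lets \<open>parent_unique\<close> see that its path avoids a forbidden
  vertex.\<close>

lemma rtranclp_imp_distinct_list:
  assumes "R\<^sup>*\<^sup>* x y"
  shows "\<exists>xs. distinct xs \<and> successively R xs \<and> xs \<noteq> [] \<and> hd xs = x \<and> last xs = y \<and>
    (\<forall>v\<in>set xs. R\<^sup>*\<^sup>* v y)"
  using assms
proof (induction rule: converse_rtranclp_induct)
  case base
  show ?case by (rule exI[of _ "[y]"]) simp
next
  case (step x z)
  then obtain xs where xs: "distinct xs" "successively R xs" "xs \<noteq> []" "hd xs = z" "last xs = y"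
    "\<forall>v\<in>set xs. R\<^sup>*\<^sup>* v y"
    by blast
  show ?case
  proof (cases "x \<in> set xs")
    case True
    then obtain us vs where "xs = us @ x # vs" by (meson split_list)
    with xs show ?thesis
      by (intro exI[of _ "x # vs"]) (auto simp: successively_append_iff)
  next
    case False
    moreover have "R\<^sup>*\<^sup>* x y" using step by (meson converse_rtranclp_into_rtranclp)
    ultimately show ?thesis using xs step(1)
      by (intro exI[of _ "x # xs"]) (auto simp: successively_Cons)
  qed
qed

text \<open>For \<open>u \<ge> 0\<close> the weights are the Poisson law of the number of jumps of a
  rate-one walk up to time \<open>u\<close>, and the sum is its generating function.\<close>

lemma exp_mult_sums:
  fixes u r c :: real
  shows "(\<lambda>n. exp (- u) * (u ^ n / fact n) * (c * r ^ n)) sums (c * exp (u * (r - 1)))"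
proof -
  have "(\<lambda>n. (u * r) ^ n / fact n) sums exp (u * r)"
    using exp_converges[of "u * r"] by (simp add: divide_inverse mult.commute)
  from sums_mult[OF this, of "c * exp (- u)"] show ?thesis
    by (simp add: power_mult_distrib mult_ac algebra_simps exp_minus exp_diff divide_inverse)
qed

lemma exponential_decay:
  fixes a c g l :: real
  assumes "g - 1 - a * l < 0"
  shows "((\<lambda>u. exp (- (a * u) * l) * c * exp (u * (g - 1))) \<longlongrightarrow> 0) at_top"
proof -
  have "filterlim (\<lambda>u. (g - 1 - a * l) * u) at_bot at_top"
    by (rule filterlim_tendsto_neg_mult_at_bot[OF tendsto_const assms filterlim_ident])
  then have "((\<lambda>u. c * exp ((g - 1 - a * l) * u)) \<longlongrightarrow> c * 0) at_top"
    by (intro tendsto_mult tendsto_const filterlim_compose[OF exp_at_bot])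
  then show ?thesis
    by (simp add: algebra_simps exp_add exp_diff exp_minus divide_inverse)
qed

text \<open>The transition operator of simple random walk: the identity minus the Laplacian.\<close>

definition averaging :: "nat \<Rightarrow> ('a \<Rightarrow> 'a \<Rightarrow> bool) \<Rightarrow> ('a \<Rightarrow> real) \<Rightarrow> 'a \<Rightarrow> real" where
  "averaging q adj f x = (\<Sum>y | adj x y. f y) / (real q + 1)"

section \<open>Tree geometry seen from the root\<close>

locale rooted_tree =
  fixes q :: nat and adj :: "'a \<Rightarrow> 'a \<Rightarrow> bool" and x0 :: 'a
  assumes q: "q \<ge> 2" and tree: "homogeneous_tree q adj"
begin

abbreviation height :: "'a \<Rightarrow> nat" where "height x \<equiv> graph_dist adj x x0"
abbreviation P :: "('a \<Rightarrow> real) \<Rightarrow> 'a \<Rightarrow> real" where "P \<equiv> averaging q adj"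

lemma adj_sym: "adj x y \<Longrightarrow> adj y x"
  and adj_irrefl: "\<not> adj x x"
  and adj_connected: "adj\<^sup>*\<^sup>* x y"
  and acyclic: "\<not> graph_cycle adj xs"
  and card_adj: "card {y. adj x y} = q + 1"
  using tree unfolding homogeneous_tree_def by blast+

lemma finite_adj: "finite {y. adj x y}"
  using card_adj[of x] by (intro card_ge_0_finite) simp

lemma relpowp_height: "(adj ^^ height x) x x0"
proof -
  obtain n where "(adj ^^ n) x x0"
    using adj_connected[of x x0] rtranclp_imp_relpowp by metis
  then show ?thesis unfolding graph_dist_def by (rule LeastI)
qed

lemma height_le: "(adj ^^ n) x x0 \<Longrightarrow> height x \<le> n"
  unfolding graph_dist_def by (rule Least_le)

lemma height_root [simp]: "height x0 = 0"
  using height_le[of 0 x0] by simp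

lemma height_eq_0_iff: "height x = 0 \<longleftrightarrow> x = x0"
  using relpowp_height[of x] by auto

lemma height_adj_le: "adj x y \<Longrightarrow> height x \<le> Suc (height y)"
  by (meson height_le relpowp_Suc_I2 relpowp_height)

lemma obtain_parent:
  assumes "x \<noteq> x0"
  obtains y where "adj x y" "height x = Suc (height y)"
proof -
  obtain n where n: "height x = Suc n"
    using assms height_eq_0_iff not0_implies_Suc by metis
  then have "(adj ^^ Suc n) x x0" using relpowp_height[of x] by metis
  then obtain y where y: "adj x y" "(adj ^^ n) y x0" by (metis relpowp_Suc_D2)
  then have "height y \<le> n" "height x \<le> Suc (height y)"
    using height_le height_adj_le by blast+
  then show thesis using that[of y] y(1) n by linarith
qed

text \<open>Following parents strictly lowers the height, so a vertex other than \<open>x\<close>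
  and no higher than \<open>x\<close> descends to the root without meeting \<open>x\<close>.\<close>

lemma connected_to_root_avoiding:
  assumes "height v \<le> height x" "v \<noteq> x"
  shows "(\<lambda>u w. adj u w \<and> u \<noteq> x \<and> w \<noteq> x)\<^sup>*\<^sup>* v x0"
  using assms
proof (induction "height v" arbitrary: v)
  case 0
  then show ?case by (simp add: height_eq_0_iff)
next
  case (Suc n)
  then have "v \<noteq> x0" by auto
  then obtain w where w: "adj v w" "height v = Suc (height w)" by (rule obtain_parent)
  with Suc have "w \<noteq> x" "n = height w" "height w \<le> height x" by auto
  then have "(\<lambda>u w. adj u w \<and> u \<noteq> x \<and> w \<noteq> x)\<^sup>*\<^sup>* w x0" by (intro Suc(1))
  moreover have "adj v w \<and> v \<noteq> x \<and> w \<noteq> x" using w(1) Suc.prems(2) \<open>w \<noteq> x\<close> by blast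
  ultimately show ?case by (rule converse_rtranclp_into_rtranclp[rotated])
qed

text \<open>Two such neighbours are joined through the root by a path avoiding \<open>x\<close>, and
  closing it up at \<open>x\<close> gives a cycle. With \<open>obtain_parent\<close>, the non-strict
  inequalities also exclude edges inside a level.\<close>

lemma parent_unique:
  assumes "adj x y" "adj x z" "height y \<le> height x" "height z \<le> height x"
  shows "y = z"
proof (rule ccontr)
  assume "y \<noteq> z"
  let ?R = "\<lambda>u w. adj u w \<and> u \<noteq> x \<and> w \<noteq> x"
  have ne: "y \<noteq> x" "z \<noteq> x" using assms adj_irrefl by blast+
  have sym: "symp ?R" using adj_sym by (auto simp: symp_def)
  have "?R\<^sup>*\<^sup>* y x0" "?R\<^sup>*\<^sup>* z x0"
    using connected_to_root_avoiding assms ne by blast+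
  moreover from this(2) have "?R\<^sup>*\<^sup>* x0 z"
    by (rule sympD[OF symp_rtranclp[OF sym]])
  ultimately have "?R\<^sup>*\<^sup>* y z" by (meson rtranclp_trans)
  then obtain xs where xs: "distinct xs" "successively ?R xs" "xs \<noteq> []" "hd xs = y" "last xs = z"
    "\<forall>v\<in>set xs. ?R\<^sup>*\<^sup>* v z"
    using rtranclp_imp_distinct_list[of ?R y z] by blast
  have adj_xs: "successively adj xs"
    using xs(2) by (rule successively_mono) auto
  \<comment> \<open>The relation has no step out of \<open>x\<close>, so \<open>x\<close> could
    reach \<open>z\<close> only by being equal to it.\<close>
  have nx: "x \<notin> set xs"
  proof
    assume "x \<in> set xs"
    with xs have "?R\<^sup>*\<^sup>* x z" by blast
    then show False using ne by (cases rule: converse_rtranclpE) auto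
  qed
  have "length xs \<ge> 2" using xs(3-5) \<open>y \<noteq> z\<close>
    by (cases xs; cases "tl xs") auto
  moreover have "adj z x" using assms adj_sym by blast
  ultimately have "graph_cycle adj (x # xs)"
    using xs nx adj_xs assms(1) by (auto simp: graph_cycle_def successively_Cons)
  then show False using acyclic by blast
qed

text \<open>By \<open>parent_unique\<close> the parent is the only neighbour not one step farther
  from the root. Averages of radial functions thus become a recursion in the height.\<close>

lemma sum_adj_height:
  fixes F :: "nat \<Rightarrow> real"
  shows "x \<noteq> x0 \<Longrightarrow> (\<Sum>y | adj x y. F (height y)) = F (height x - 1) + q * F (height x + 1)"
    and "(\<Sum>y | adj x0 y. F (height y)) = (q + 1) * F 1"
proof -
  have up: "height y = height x + 1" if "adj x y" "\<not> height y \<le> height x" for x y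
    using that height_adj_le[of y x] adj_sym[of x y] by auto
  {
    assume "x \<noteq> x0"
    then obtain p where p: "adj x p" "height x = Suc (height p)" by (rule obtain_parent)
    have "height y = height x + 1" if "y \<in> {y. adj x y} - {p}" for y
      using that up parent_unique[of x y p] p by force
    then have "(\<Sum>y\<in>{y. adj x y} - {p}. F (height y)) = q * F (height x + 1)"
      using p card_adj[of x] finite_adj[of x] by (simp add: card_Diff_singleton)
    then show "(\<Sum>y | adj x y. F (height y)) = F (height x - 1) + q * F (height x + 1)"
      using p finite_adj[of x] by (subst sum.remove[of _ p]) auto
  }
  have "height y = 1" if "adj x0 y" for y
    using that up[of x0 y] adj_irrefl by (auto simp: height_eq_0_iff)
  then show "(\<Sum>y | adj x0 y. F (height y)) = (q + 1) * F 1"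
    using card_adj[of x0] by simp
qed

lemma finite_height_le: "finite {x. height x \<le> n}"
proof (induction n)
  case 0
  then show ?case by (simp add: height_eq_0_iff)
next
  case (Suc n)
  have "{x. height x \<le> Suc n} \<subseteq> {x. height x \<le> n} \<union> (\<Union>y\<in>{x. height x \<le> n}. {x. adj y x})"
  proof
    fix x assume "x \<in> {x. height x \<le> Suc n}"
    then have "height x \<le> Suc n" by simp
    show "x \<in> {x. height x \<le> n} \<union> (\<Union>y\<in>{x. height x \<le> n}. {x. adj y x})"
    proof (cases "x = x0")
      case False
      then obtain y where "adj x y" "height x = Suc (height y)" by (rule obtain_parent)
      with \<open>height x \<le> Suc n\<close> show ?thesis by (auto intro: adj_sym)
    qed simp
  qed
  then show ?case using Suc finite_adj by (meson finite_UN_I finite_UnI finite_subset)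
qed

section \<open>Powers of the averaging operator\<close>

lemma averaging_mono: "(\<And>x. f x \<le> g x) \<Longrightarrow> P f x \<le> P g x"
  unfolding averaging_def by (intro divide_right_mono sum_mono) auto

lemma averaging_const [simp]: "P (\<lambda>_. c) = (\<lambda>_. c)"
  using card_adj by (auto simp: averaging_def fun_eq_iff add.commute[of 1])

lemma averaging_sum: "P (\<lambda>y. \<Sum>i\<in>I. c i * f i y) x = (\<Sum>i\<in>I. c i * P (f i) x)"
  unfolding averaging_def
  by (subst sum.swap) (simp add: sum_divide_distrib sum_distrib_left)

lemma averaging_cmult: "P (\<lambda>y. c * f y) x = c * P f x"
  using averaging_sum[of "\<lambda>_. c" "\<lambda>_. f" "{()}"] by simp

lemma averaging_add: "P (\<lambda>y. f y + g y) x = P f x + P g x"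
  unfolding averaging_def by (simp add: sum.distrib add_divide_distrib)

lemma averaging_power_mono: "(\<And>x. f x \<le> g x) \<Longrightarrow> (P ^^ n) f x \<le> (P ^^ n) g x"
  by (induction n arbitrary: x) (auto intro!: averaging_mono)

lemma averaging_power_sum: "(P ^^ n) (\<lambda>y. \<Sum>i\<in>I. c i * f i y) x = (\<Sum>i\<in>I. c i * (P ^^ n) (f i) x)"
proof (induction n arbitrary: x)
  case (Suc n)
  have "(P ^^ Suc n) (\<lambda>y. \<Sum>i\<in>I. c i * f i y) x = P ((P ^^ n) (\<lambda>y. \<Sum>i\<in>I. c i * f i y)) x"
    by simp
  also have "\<dots> = P (\<lambda>x. (\<Sum>i\<in>I. c i * (P ^^ n) (f i) x)) x"
    using Suc by presburger
  finally show ?case by (simp add: averaging_sum)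
qed simp

lemma averaging_power_add: "(P ^^ n) (\<lambda>y. f y + g y) x = (P ^^ n) f x + (P ^^ n) g x"
  using averaging_power_sum[of n "\<lambda>_. 1" "\<lambda>b. if b then f else g" UNIV] by (simp add: UNIV_bool add.commute)

lemma averaging_power_cmult: "(P ^^ n) (\<lambda>y. c * f y) x = c * (P ^^ n) f x"
  using averaging_power_sum[of n "\<lambda>_. c" "\<lambda>_. f" "{()}"] by simp

lemma averaging_power_const [simp]: "(P ^^ n) (\<lambda>_. c) x = c"
  by (induction n arbitrary: x) (simp_all add: funpow_swap1)

lemma averaging_power_bounds:
  assumes "\<And>x. 0 \<le> f x" "\<And>x. f x \<le> 1"
  shows "0 \<le> (P ^^ n) f x" "(P ^^ n) f x \<le> 1"
  using averaging_power_mono[of "\<lambda>_. 0" f n x] averaging_power_mono[of f "\<lambda>_. 1" n x] assms by auto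

text \<open>\<open>P\<close> is monotone and linear, so the one-step inequality can be
  iterated.\<close>

lemma averaging_power_supersolution:
  assumes "\<And>x. P f x \<le> r * f x" "0 \<le> r"
  shows "(P ^^ n) f x \<le> r ^ n * f x"
proof (induction n arbitrary: x)
  case (Suc n)
  have "(P ^^ Suc n) f x \<le> P (\<lambda>x. r ^ n * f x) x"
    using Suc by (auto intro!: averaging_mono)
  also have "\<dots> \<le> r ^ n * (r * f x)"
    using assms by (simp add: averaging_cmult mult_left_mono)
  finally show ?case by (simp add: mult_ac)
qed simp

text \<open>All degrees are equal, so the transition matrix is symmetric, and with it every
  power.\<close>

lemma averaging_power_sym:
  "(P ^^ n) (\<lambda>z. if z = y then 1 else 0) x = (P ^^ n) (\<lambda>z. if z = x then 1 else 0) y"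
proof (induction n arbitrary: x y)
  case (Suc n)
  have eq: "P (\<lambda>z. if z = x then 1 else 0) =
      (\<lambda>w. \<Sum>z | adj x z. 1 / (real q + 1) * (if w = z then 1 else 0))" for x
  proof
    fix w
    have "P (\<lambda>z. if z = x then 1 else 0) w = (if adj w x then 1 else 0) / (real q + 1)"
      using finite_adj[of w] by (simp add: averaging_def)
    also have "\<dots> = (\<Sum>z | adj x z. 1 / (real q + 1) * (if w = z then 1 else 0))"
      using finite_adj[of x] adj_sym[of x w] adj_sym[of w x] by (auto simp: if_distrib cong: if_cong)
    finally show "P (\<lambda>z. if z = x then 1 else 0) w = \<dots>" .
  qed
  \<comment> \<open>The innermost operator is peeled off here, because it spreads the delta over the
    neighbours of \<open>x\<close>; the outermost operator on the other side averages over these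
    same neighbours.\<close>
  have "(P ^^ Suc n) (\<lambda>z. if z = x then 1 else 0) y =
      (P ^^ n) (P (\<lambda>z. if z = x then 1 else 0)) y"
    by (simp only: funpow_Suc_right comp_def)
  also have "\<dots> = (\<Sum>z | adj x z. 1 / (real q + 1) * (P ^^ n) (\<lambda>w. if w = z then 1 else 0) y)"
    unfolding eq by (rule averaging_power_sum)
  also have "\<dots> = P ((P ^^ n) (\<lambda>z. if z = y then 1 else 0)) x"
    by (simp add: averaging_def[of q adj "(averaging q adj ^^ n) _"] Suc sum_divide_distrib)
  finally show ?case by simp
qed auto

text \<open>Symmetry trades evolving a delta and summing over \<open>F\<close> for evolving the
  indicator of \<open>F\<close> and evaluating at the root.\<close>

lemma sum_averaging_power_delta:
  assumes "finite F"
  shows "(\<Sum>x\<in>F. (P ^^ n) (\<lambda>z. if z = x0 then 1 else 0) x) = (P ^^ n) (indicator F) x0"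
proof -
  have "indicator F = (\<lambda>z. \<Sum>x\<in>F. 1 * (if z = x then 1 else 0 :: real))"
    using assms by (auto simp: fun_eq_iff indicator_def)
  then show ?thesis by (simp only: averaging_power_sum) (simp add: averaging_power_sym[of n x0])
qed

text \<open>Binomial expansion of the \<open>n\<close>-th power of the identity minus
  \<open>P\<close>.\<close>

lemma laplacian_power:
  "(laplacian q adj ^^ n) f x = (\<Sum>k\<le>n. real (n choose k) * (- 1) ^ k * (P ^^ k) f x)"
proof (induction n arbitrary: x)
  case (Suc n)
  define a where "a k = (- 1) ^ k * (P ^^ k) f x" for k
  have "(laplacian q adj ^^ Suc n) f x = laplacian q adj ((laplacian q adj ^^ n) f) x" by simp
  also have "(laplacian q adj ^^ n) f = (\<lambda>x. \<Sum>k\<le>n. real (n choose k) * (- 1) ^ k * (P ^^ k) f x)"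
    using Suc by blast
  also have "laplacian q adj \<dots> x = (\<Sum>k\<le>n. real (n choose k) * (- 1) ^ k * (P ^^ k) f x)
      - P (\<lambda>x. \<Sum>k\<le>n. real (n choose k) * (- 1) ^ k * (P ^^ k) f x) x"
    by (simp add: laplacian_def averaging_def)
  also have "\<dots> = (\<Sum>k\<le>n. real (n choose k) * a k) + (\<Sum>k\<le>n. real (n choose k) * a (Suc k))"
    by (simp add: averaging_sum averaging_cmult a_def sum_negf mult.assoc)
  \<comment> \<open>The added term has coefficient zero; it aligns the two sums for Pascal's
    rule.\<close>
  also have "(\<Sum>k\<le>n. real (n choose k) * a k) = (\<Sum>k\<le>Suc n. real (n choose k) * a k)"
    by simp
  also have "\<dots> = a 0 + (\<Sum>k\<le>n. real (n choose Suc k) * a (Suc k))"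
    by (simp only: sum.atMost_Suc_shift) simp
  also have "\<dots> + (\<Sum>k\<le>n. real (n choose k) * a (Suc k)) =
      a 0 + (\<Sum>k\<le>n. real (Suc n choose Suc k) * a (Suc k))"
    by (simp add: sum.distrib distrib_right)
  also have "\<dots> = (\<Sum>k\<le>Suc n. real (Suc n choose k) * a k)"
    by (simp only: sum.atMost_Suc_shift) simp
  finally show ?case by (simp add: a_def mult.assoc)
qed simp

text \<open>The semigroup factors as \<open>exp (- u)\<close> times the exponential of
  \<open>u\<close> times \<open>P\<close>: the defining series is the Cauchy product of the two. For
  \<open>u \<ge> 0\<close> the resulting terms are nonnegative, so estimates can be made term by
  term.\<close>

lemma heat_semigroup_sums:
  assumes "\<And>x. 0 \<le> f x" "\<And>x. f x \<le> 1"
  shows "(\<lambda>n. exp (- u) * (u ^ n / fact n) * (P ^^ n) f y) sums heat_semigroup q adj u f y"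
proof -
  let ?a = "\<lambda>k. u ^ k / fact k * (P ^^ k) f y"
  let ?b = "\<lambda>k. (- u) ^ k / fact k"
  have a: "summable (\<lambda>k. norm (?a k))"
  proof (rule summable_comparison_test')
    show "summable (\<lambda>k. \<bar>u\<bar> ^ k / fact k)"
      using summable_exp_generic[of "\<bar>u\<bar>"] by (simp add: divide_inverse mult.commute)
    show "norm (norm (?a n)) \<le> \<bar>u\<bar> ^ n / fact n" for n
      using averaging_power_bounds[of f n y] assms
        mult_left_le[of "(P ^^ n) f y" "\<bar>u\<bar> ^ n / fact n"]
      by (auto simp: abs_mult power_abs)
  qed
  have b: "summable (\<lambda>k. norm (?b k))"
    using summable_norm_exp[of "- u"] by (simp add: divide_inverse mult.commute)
  have exp: "(\<Sum>k. ?b k) = exp (- u)"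
    unfolding exp_def by (simp add: divide_inverse mult.commute)
  have term_eq: "(\<Sum>i\<le>n. ?a i * ?b (n - i)) = (- u) ^ n / fact n * (laplacian q adj ^^ n) f y" for n
  proof -
    have "?a i * ?b (n - i) = (- u) ^ n / fact n * (real (n choose i) * (- 1) ^ i * (P ^^ i) f y)"
      if "i \<le> n" for i
    proof -
      have "(- u) ^ n = (- u) ^ i * (- u) ^ (n - i)"
        using that by (simp flip: power_add)
      also have "(- u) ^ i = (- 1) ^ i * u ^ i" by (rule power_minus)
      finally have "(- u) ^ n * (- 1) ^ i = u ^ i * (- u) ^ (n - i)"
        by (simp flip: power_mult_distrib add: mult_ac)
      moreover have "real (n choose i) = fact n / (fact i * fact (n - i))"
        by (rule binomial_fact[OF that])
      ultimately show ?thesis by (simp add: field_simps)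
    qed
    then show ?thesis by (simp add: laplacian_power sum_distrib_left)
  qed
  have "(\<lambda>n. \<Sum>i\<le>n. ?a i * ?b (n - i)) sums ((\<Sum>k. ?a k) * (\<Sum>k. ?b k))"
    by (rule Cauchy_product_sums[OF a b])
  then have "heat_semigroup q adj u f y = exp (- u) * (\<Sum>k. ?a k)"
    unfolding heat_semigroup_def term_eq exp by (simp add: sums_iff mult.commute)
  moreover have "(\<lambda>k. exp (- u) * ?a k) sums (exp (- u) * (\<Sum>k. ?a k))"
    by (intro sums_mult summable_sums summable_norm_cancel[OF a])
  ultimately show ?thesis by (simp add: mult.assoc)
qed

section \<open>Heat mass of a set of vertices\<close>

text \<open>For \<open>u \<ge> 0\<close>, the probability that the continuous-time walk from the
  root is in \<open>F\<close> at time \<open>u\<close>. Evolving the indicator also makes sense for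
  infinite \<open>F\<close>, in particular for complements of finite sets.\<close>

definition heat_mass :: "real \<Rightarrow> 'a set \<Rightarrow> real" where
  "heat_mass u F = heat_semigroup q adj u (indicator F) x0"

lemma heat_mass_sums:
  "(\<lambda>n. exp (- u) * (u ^ n / fact n) * (P ^^ n) (indicator F) x0) sums heat_mass u F"
  unfolding heat_mass_def by (rule heat_semigroup_sums) auto

lemma sum_heat_kernel:
  assumes "finite F"
  shows "(\<Sum>x\<in>F. heat_kernel q adj x0 u x) = heat_mass u F"
proof -
  have "(\<lambda>n. \<Sum>x\<in>F. exp (- u) * (u ^ n / fact n) * (P ^^ n) (\<lambda>z. if z = x0 then 1 else 0) x)
      sums (\<Sum>x\<in>F. heat_kernel q adj x0 u x)"
    unfolding heat_kernel_def by (intro sums_sum heat_semigroup_sums) auto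
  then show ?thesis
    unfolding sum_distrib_left[symmetric] sum_averaging_power_delta[OF assms]
    using heat_mass_sums sums_unique2 by blast
qed

lemma heat_mass_nonneg: "0 \<le> u \<Longrightarrow> 0 \<le> heat_mass u F"
  by (rule sums_le[OF _ sums_zero heat_mass_sums])
    (intro mult_nonneg_nonneg divide_nonneg_nonneg averaging_power_bounds zero_le_power; simp)

text \<open>Exponential Chebyshev bound: \<open>c * f\<close> majorises the indicator, each step of
  the walk costs a factor \<open>r\<close>, and the Poisson number of steps is averaged out.\<close>

lemma heat_mass_le:
  assumes "0 \<le> u" "0 \<le> r" "\<And>x. P f x \<le> r * f x" "\<And>x. indicator F x \<le> c * f x" "0 \<le> c"
  shows "heat_mass u F \<le> c * f x0 * exp (u * (r - 1))"
proof (rule sums_le[OF _ heat_mass_sums exp_mult_sums])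
  fix n
  have "(P ^^ n) (indicator F) x0 \<le> c * (P ^^ n) f x0"
    using averaging_power_mono[of "indicator F" "\<lambda>x. c * f x" n x0] assms(4)
    by (simp add: averaging_power_cmult)
  also have "\<dots> \<le> c * (r ^ n * f x0)"
    using averaging_power_supersolution[OF assms(3,2)] assms(5) by (intro mult_left_mono)
  finally show "exp (- u) * (u ^ n / fact n) * (P ^^ n) (indicator F) x0 \<le>
      exp (- u) * (u ^ n / fact n) * (c * f x0 * r ^ n)"
    using assms(1) by (intro mult_left_mono) (auto simp: mult_ac)
qed

lemma heat_mass_le_1: "0 \<le> u \<Longrightarrow> heat_mass u F \<le> 1"
  using heat_mass_le[of u 1 "\<lambda>_. 1" F 1] by simp

lemma heat_mass_mono:
  assumes "0 \<le> u" "F \<subseteq> G" shows "heat_mass u F \<le> heat_mass u G"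
proof (rule sums_le[OF _ heat_mass_sums heat_mass_sums])
  show "exp (- u) * (u ^ n / fact n) * (P ^^ n) (indicator F) x0 \<le>
      exp (- u) * (u ^ n / fact n) * (P ^^ n) (indicator G) x0" for n
    using assms by (intro mult_left_mono averaging_power_mono) (auto split: split_indicator)
qed

lemma heat_mass_compl: "heat_mass u F + heat_mass u (- F) = 1"
proof -
  have "(P ^^ n) (indicator F) x0 + (P ^^ n) (indicator (- F)) x0 = 1" for n
    using averaging_power_const[of n 1 x0]
    unfolding averaging_power_add[symmetric] indicator_compl by simp
  then have "(\<lambda>n. exp (- u) * (u ^ n / fact n)) sums (heat_mass u F + heat_mass u (- F))"
    using sums_add[OF heat_mass_sums[of u F] heat_mass_sums[of u "- F"]]
    by (simp only: distrib_left[symmetric] mult_1_right)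
  then show ?thesis using exp_mult_sums[of u 1 1] by (simp add: sums_iff)
qed

lemma heat_mass_Un: 
  assumes "0 \<le> u" shows "heat_mass u (F \<union> G) \<le> heat_mass u F + heat_mass u G"
proof (rule sums_le[OF _ heat_mass_sums sums_add[OF heat_mass_sums heat_mass_sums]])
  fix n
  have "(P ^^ n) (indicator (F \<union> G)) x0 \<le> (P ^^ n) (\<lambda>x. indicator F x + indicator G x) x0"
    by (rule averaging_power_mono) (auto split: split_indicator)
  then show "exp (- u) * (u ^ n / fact n) * (P ^^ n) (indicator (F \<union> G)) x0 \<le>
      exp (- u) * (u ^ n / fact n) * (P ^^ n) (indicator F) x0 +
      exp (- u) * (u ^ n / fact n) * (P ^^ n) (indicator G) x0"
    unfolding distrib_left[symmetric] averaging_power_add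
    by (rule mult_left_mono) (use assms in simp)
qed

lemma borel_measurable_heat_mass [measurable]: "(\<lambda>u. heat_mass u F) \<in> borel_measurable borel"
proof -
  have "(\<lambda>u. heat_mass u F) = (\<lambda>u. \<Sum>n. exp (- u) * (u ^ n / fact n) * (P ^^ n) (indicator F) x0)"
    using heat_mass_sums by (simp add: sums_iff)
  then show ?thesis by simp
qed

section \<open>Concentration of the heat mass at linear speed\<close>

definition speed :: real where "speed = (real q - 1) / (real q + 1)"

lemma speed_pos: "0 < speed"
  using q by (simp add: speed_def)

text \<open>The eigenvalue of \<open>P\<close>, away from the root, on \<open>r ^ height\<close>:
  \<open>q\<close> children contribute \<open>r\<close> each and the parent contributes
  \<open>1 / r\<close>.\<close>

definition growth :: "real \<Rightarrow> real" where
  "growth r = (real q * r + 1 / r) / (real q + 1)"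

text \<open>The function is the exponential rate of the Chebyshev bound at height
  \<open>a * u\<close> with tilt \<open>r\<close>. It vanishes at \<open>r = 1\<close>, so the sign
  of the derivative tells on which side of \<open>1\<close> the rate becomes negative.\<close>

lemma growth_exponent_deriv:
  "((\<lambda>r. growth r - 1 - a * ln r) has_real_derivative speed - a) (at 1)"
  unfolding growth_def[abs_def] speed_def
  by (rule derivative_eq_intros refl | simp)+

lemma averaging_power_height:
  assumes "0 < r"
  shows "x \<noteq> x0 \<Longrightarrow> P (\<lambda>x. r ^ height x) x = growth r * r ^ height x"
    and "P (\<lambda>x. r ^ height x) x0 = r"
proof -
  {
    assume "x \<noteq> x0"
    then obtain n where n: "height x = Suc n"
      using height_eq_0_iff not0_implies_Suc by metis
    have "P (\<lambda>x. r ^ height x) x = (q * r * r + 1) / (q + 1) * r ^ n"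
      using sum_adj_height(1)[OF \<open>x \<noteq> x0\<close>, of "\<lambda>n. r ^ n"] n
      by (simp add: averaging_def algebra_simps)
    also have "(q * r * r + 1) / (q + 1) = growth r * r"
      using assms by (simp add: growth_def distrib_right)
    finally show "P (\<lambda>x. r ^ height x) x = growth r * r ^ height x"
      using n by simp
  }
  show "P (\<lambda>x. r ^ height x) x0 = r"
    using sum_adj_height(2)[of "\<lambda>n. r ^ n"] by (simp add: averaging_def field_simps)
qed

text \<open>Only the root needs an argument: the average there is \<open>r\<close>, while
  \<open>growth r\<close> is a weighted mean of \<open>r\<close> and the larger number
  \<open>1 / r\<close>.\<close>

lemma supersolution_lt_1:
  assumes "0 < r" "r < 1"
  shows "P (\<lambda>x. r ^ height x) x \<le> growth r * r ^ height x"
proof (cases "x = x0")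
  case True
  have "r * r \<le> 1" using assms by (simp add: mult_le_one)
  then have "r \<le> 1 / r" using assms by (simp add: field_simps)
  then have "r \<le> growth r" by (simp add: growth_def pos_le_divide_eq algebra_simps)
  then show ?thesis using averaging_power_height[OF assms(1)] True by simp
qed (simp add: averaging_power_height assms)

text \<open>At the root \<open>r ^ height\<close> alone is not a supersolution when \<open>r > 1\<close>; a constant large
  enough to absorb the defect there is harmless since \<open>growth r > 1\<close>.\<close>

lemma supersolution_gt_1:
  assumes "1 < r"
  obtains K where "0 \<le> K" "\<And>x. P (\<lambda>x. r ^ height x + K) x \<le> growth r * (r ^ height x + K)"
proof
  \<comment> \<open>The product is \<open>q * r * r - (q + 1) * r + 1\<close>; dividing by
    \<open>r\<close> yields \<open>growth r > 1\<close>.\<close>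
  have "0 < (r - 1) * (real q * r - 1)"
    using assms q mult_mono[of 2 "real q" 1 r] by (intro mult_pos_pos) auto
  then have "real q + 1 < real q * r + 1 / r"
    using assms by (simp add: field_simps)
  then have gr: "1 < growth r" by (simp add: growth_def pos_less_divide_eq)
  define K where "K = r / (growth r - 1)"
  show "0 \<le> K" using gr assms by (simp add: K_def)
  have K: "r = (growth r - 1) * K" using gr by (simp add: K_def)
  fix x
  show "P (\<lambda>x. r ^ height x + K) x \<le> growth r * (r ^ height x + K)"
  proof (cases "x = x0")
    case True
    with assms gr K show ?thesis
      by (simp add: averaging_add averaging_power_height algebra_simps)
  next
    case False
    have "1 * K \<le> growth r * K" using gr \<open>0 \<le> K\<close> by (intro mult_right_mono) auto
    with False assms show ?thesis
      by (simp add: averaging_add averaging_power_height algebra_simps)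
  qed
qed

text \<open>For \<open>a < speed\<close> the rate increases through zero at \<open>r = 1\<close>, so
  a tilt slightly below \<open>1\<close> gives exponential decay.\<close>

lemma heat_mass_low_tendsto:
  assumes "a < speed"
  shows "((\<lambda>u. heat_mass u {x. real (height x) \<le> a * u}) \<longlongrightarrow> 0) at_top"
proof -
  obtain d where d: "0 < d"
    "\<And>h. 0 < h \<Longrightarrow> h < d \<Longrightarrow> growth (1 - h) - 1 - a * ln (1 - h) < growth 1 - 1 - a * ln 1"
    using DERIV_pos_inc_left[OF growth_exponent_deriv[of a]] assms by auto
  \<comment> \<open>The minimum with \<open>1 / 2\<close> keeps \<open>r\<close> positive when
    \<open>d\<close> is large.\<close>
  define r where "r = 1 - min (d / 2) (1 / 2)"
  have r: "0 < r" "r < 1" using d(1) by (auto simp: r_def)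
  have neg: "growth r - 1 - a * ln r < 0"
    using d(2)[of "1 - r"] d(1) by (auto simp: r_def growth_def field_simps)
  have bound: "heat_mass u {x. real (height x) \<le> a * u}
      \<le> exp (- (a * u) * ln r) * 1 * exp (u * (growth r - 1))" if "0 \<le> u" for u
  proof -
    have "indicator {x. real (height x) \<le> a * u} x \<le> exp (- (a * u) * ln r) * r ^ height x" for x
    proof -
      have pow: "r ^ height x = exp (real (height x) * ln r)"
        using r by (simp add: exp_of_nat_mult)
      have "(a * u - height x) * ln r \<le> 0" if "real (height x) \<le> a * u"
        using that r by (intro mult_nonneg_nonpos) auto
      moreover have "exp (- (a * u) * ln r) * r ^ height x = exp (- ((a * u - height x) * ln r))"
        unfolding pow by (simp add: mult_exp_exp algebra_simps)
      ultimately show ?thesis by (auto split: split_indicator)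
    qed
    then show ?thesis
      using heat_mass_le[OF that _ supersolution_lt_1[OF r], of _ "exp (- (a * u) * ln r)"] r
      by (simp add: growth_def)
  qed
  show ?thesis
    by (rule tendsto_sandwich[OF _ _ tendsto_const exponential_decay[OF neg, of 1]])
      (auto intro!: eventually_at_top_linorderI[of 0] heat_mass_nonneg bound[simplified])
qed

text \<open>Mirror image with a tilt above \<open>1\<close>; the correction at the root costs only
  the constant factor \<open>1 + K\<close>.\<close>

lemma heat_mass_high_tendsto:
  assumes "speed < a"
  shows "((\<lambda>u. heat_mass u {x. a * u \<le> real (height x)}) \<longlongrightarrow> 0) at_top"
proof -
  obtain d where d: "0 < d"
    "\<And>h. 0 < h \<Longrightarrow> h < d \<Longrightarrow> growth (1 + h) - 1 - a * ln (1 + h) < growth 1 - 1 - a * ln 1"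
    using DERIV_neg_dec_right[OF growth_exponent_deriv[of a]] assms by auto
  define r where "r = 1 + d / 2"
  have r: "1 < r" using d(1) by (auto simp: r_def)
  have neg: "growth r - 1 - a * ln r < 0"
    using d(2)[of "d / 2"] d(1) by (auto simp: r_def growth_def field_simps)
  obtain K where K: "0 \<le> K" "\<And>x. P (\<lambda>x. r ^ height x + K) x \<le> growth r * (r ^ height x + K)"
    using supersolution_gt_1[OF r] by blast
  have bound: "heat_mass u {x. a * u \<le> real (height x)}
      \<le> exp (- (a * u) * ln r) * (1 + K) * exp (u * (growth r - 1))" if "0 \<le> u" for u
  proof -
    have "indicator {x. a * u \<le> real (height x)} x \<le> exp (- (a * u) * ln r) * (r ^ height x + K)" for x
    proof -
      have pow: "r ^ height x = exp (real (height x) * ln r)"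
        using r by (simp add: exp_of_nat_mult)
      have "1 \<le> exp ((height x - a * u) * ln r)" if "a * u \<le> real (height x)"
        using that r by simp
      moreover have "exp (- (a * u) * ln r) * r ^ height x = exp ((height x - a * u) * ln r)"
        unfolding pow by (simp add: mult_exp_exp algebra_simps)
      moreover have "0 \<le> exp (- (a * u) * ln r) * K" using K by simp
      ultimately show ?thesis unfolding distrib_left
        by (auto split: split_indicator intro: add_increasing2)
    qed
    then show ?thesis
      using heat_mass_le[OF that _ K(2), of _ "exp (- (a * u) * ln r)"] r
      by (simp add: growth_def)
  qed
  show ?thesis
    by (rule tendsto_sandwich[OF _ _ tendsto_const exponential_decay[OF neg, of "1 + K"]])
      (auto intro!: eventually_at_top_linorderI[of 0] heat_mass_nonneg bound[simplified])
qed

definition annulus :: "real \<Rightarrow> real \<Rightarrow> real \<Rightarrow> 'a set" where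
  "annulus a b s = {x. a * s \<le> real (height x) \<and> real (height x) \<le> b * s}"

text \<open>At time \<open>s * v\<close> the height is close to \<open>speed * v * s\<close>, so the
  annulus captures asymptotically all or nothing. The two boundary values of \<open>v\<close> are
  left out.\<close>

lemma heat_mass_annulus_tendsto:
  assumes v: "0 < v" and "speed * v \<noteq> a" "speed * v \<noteq> b"
  shows "((\<lambda>s. heat_mass (s * v) (annulus a b s)) \<longlongrightarrow> indicator {a<..<b} (speed * v)) at_top"
proof -
  have lim: "filterlim (\<lambda>s. s * v) at_top at_top"
    by (rule filterlim_at_top_mult_tendsto_pos[OF tendsto_const v filterlim_ident])
  have ev: "\<forall>\<^sub>F s in at_top. 0 \<le> s * v"
    using v by (intro eventually_at_top_linorderI[of 0]) simp
  have low: "((\<lambda>s. heat_mass (s * v) {x. real (height x) \<le> c * s}) \<longlongrightarrow> 0) at_top"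
    if "c < speed * v" for c
  proof -
    have "c / v < speed" using that v by (simp add: field_simps)
    from filterlim_compose[OF heat_mass_low_tendsto[OF this] lim] show ?thesis using v by simp
  qed
  have high: "((\<lambda>s. heat_mass (s * v) {x. c * s \<le> real (height x)}) \<longlongrightarrow> 0) at_top"
    if "speed * v < c" for c
  proof -
    have "speed < c / v" using that v by (simp add: field_simps)
    from filterlim_compose[OF heat_mass_high_tendsto[OF this] lim] show ?thesis using v by simp
  qed
  consider "speed * v < a" | "b < speed * v" | "a < speed * v" "speed * v < b"
    using assms by linarith
  then show ?thesis
  proof cases
    case 1
    show ?thesis
      by (rule tendsto_sandwich[OF _ _ tendsto_const high[OF 1, THEN tendsto_eq_rhs]])
        (use 1 in \<open>auto intro!: eventually_mono[OF ev] heat_mass_nonneg heat_mass_mono simp: annulus_def\<close>)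
  next
    case 2
    show ?thesis
      by (rule tendsto_sandwich[OF _ _ tendsto_const low[OF 2, THEN tendsto_eq_rhs]])
        (use 2 in \<open>auto intro!: eventually_mono[OF ev] heat_mass_nonneg heat_mass_mono simp: annulus_def\<close>)
  next
    case 3
    have lower: "1 - (heat_mass (s * v) {x. real (height x) \<le> a * s} +
        heat_mass (s * v) {x. b * s \<le> real (height x)}) \<le> heat_mass (s * v) (annulus a b s)"
      if "0 \<le> s * v" for s
    proof -
      have "heat_mass (s * v) (- annulus a b s) \<le> heat_mass (s * v)
          ({x. real (height x) \<le> a * s} \<union> {x. b * s \<le> real (height x)})"
        using that by (intro heat_mass_mono) (auto simp: annulus_def)
      also have "\<dots> \<le> heat_mass (s * v) {x. real (height x) \<le> a * s} +
          heat_mass (s * v) {x. b * s \<le> real (height x)}"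
        by (rule heat_mass_Un[OF that])
      finally show ?thesis using heat_mass_compl[of "s * v" "annulus a b s"] by linarith
    qed
    have "((\<lambda>s. 1 - (heat_mass (s * v) {x. real (height x) \<le> a * s} +
        heat_mass (s * v) {x. b * s \<le> real (height x)})) \<longlongrightarrow> 1 - (0 + 0)) at_top"
      by (intro tendsto_diff tendsto_add tendsto_const low high 3)
    then have "((\<lambda>s. heat_mass (s * v) (annulus a b s)) \<longlongrightarrow> 1 - (0 + 0)) at_top"
      by (rule tendsto_sandwich[rotated 2, OF _ tendsto_eq_rhs[OF tendsto_const[of 1]]])
        (auto intro!: eventually_mono[OF ev] heat_mass_le_1 lower)
    then show ?thesis using 3 by simp
  qed
qed

lemma finite_annulus: "finite (annulus a b s)"
proof (rule finite_subset)
  show "annulus a b s \<subseteq> {x. height x \<le> nat \<lfloor>b * s\<rfloor>}"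
    by (auto simp: annulus_def le_nat_floor)
qed (rule finite_height_le)

end

section \<open>Laplace transforms and complete monotonicity\<close>

text \<open>Bernstein polynomials of \<open>g\<close> converge uniformly, and their integrals
  involve only those of \<open>y ^ k * (1 - y) ^ m\<close>. These integrals therefore determine the
  limit and pass on their signs; the weight \<open>w\<close> may change sign.\<close>

lemma Bernstein_integral_tendsto:
  fixes y w :: "'b \<Rightarrow> real" and g :: "real \<Rightarrow> real"
  assumes y [measurable]: "y \<in> borel_measurable M" and w: "integrable M w"
    and y01: "\<And>x. 0 \<le> y x" "\<And>x. y x \<le> 1"
    and g: "continuous_on {0..1} g"
  shows "(\<lambda>n. \<Sum>k\<le>n. g (k / n) * real (n choose k) * (\<integral>x. y x ^ k * (1 - y x) ^ (n - k) * w x \<partial>M))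
    \<longlonglongrightarrow> (\<integral>x. g (y x) * w x \<partial>M)"
proof -
  have [measurable]: "w \<in> borel_measurable M" using w by simp
  define B where "B n x = (\<Sum>k\<le>n. g (k / n) * Bernstein n k x)" for n x
  have unif: "uniform_limit {0..1} B g sequentially"
    unfolding uniform_limit_iff eventually_sequentially B_def dist_real_def
    using Bernstein_Weierstrass[OF g] by (metis abs_minus_commute)
  have pointwise: "(\<lambda>n. B n (y x)) \<longlonglongrightarrow> g (y x)" for x
    using tendsto_uniform_limitI[OF unif] y01 by auto
  obtain C where C: "\<And>v. v \<in> {0..1} \<Longrightarrow> \<bar>g v\<bar> \<le> C"
    using compact_imp_bounded[OF compact_continuous_image[OF g compact_Icc]]
    by (force simp: bounded_iff)
  have B_bound: "\<bar>B n v\<bar> \<le> C" if "v \<in> {0..1}" for n v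
  proof -
    have "\<bar>B n v\<bar> \<le> (\<Sum>k\<le>n. \<bar>g (k / n) * Bernstein n k v\<bar>)" unfolding B_def by (rule sum_abs)
    \<comment> \<open>For \<open>n = 0\<close> the node \<open>k / n\<close> is \<open>0\<close> by
      convention and still lies in the unit interval.\<close>
    also have "\<dots> \<le> (\<Sum>k\<le>n. C * Bernstein n k v)"
      using that Bernstein_nonneg[of v n]
      by (intro sum_mono) (auto simp: abs_mult divide_le_eq_1 intro!: mult_right_mono C)
    also have "\<dots> = C" by (simp flip: sum_distrib_left)
    finally show ?thesis .
  qed
  have meas [measurable]: "B n \<in> borel_measurable borel" for n
    unfolding B_def Bernstein_def by measurable
  have "(\<lambda>n. \<integral>x. B n (y x) * w x \<partial>M) \<longlonglongrightarrow> (\<integral>x. g (y x) * w x \<partial>M)"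
  proof (rule integral_dominated_convergence[where w="\<lambda>x. C * \<bar>w x\<bar>"])
    \<comment> \<open>Since \<open>g\<close> is controlled only on the unit interval, measurability
      is taken from the pointwise limit.\<close>
    have "(\<lambda>x. g (y x)) \<in> borel_measurable M"
      by (rule borel_measurable_LIMSEQ_real[OF pointwise]) measurable
    then show "(\<lambda>x. g (y x) * w x) \<in> borel_measurable M" by measurable
    show "AE x in M. norm (B n (y x) * w x) \<le> C * \<bar>w x\<bar>" for n
      using B_bound y01 by (auto simp: abs_mult intro!: mult_right_mono)
    show "AE x in M. (\<lambda>n. B n (y x) * w x) \<longlonglongrightarrow> g (y x) * w x"
      by (intro AE_I2 tendsto_mult tendsto_const pointwise)
  qed (use w in auto)
  moreover have "(\<integral>x. B n (y x) * w x \<partial>M) =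
      (\<Sum>k\<le>n. g (k / n) * real (n choose k) * (\<integral>x. y x ^ k * (1 - y x) ^ (n - k) * w x \<partial>M))" for n
  proof -
    have int: "integrable M (\<lambda>x. y x ^ k * (1 - y x) ^ m * w x)" for k m
    proof (rule Bochner_Integration.integrable_bound[OF w])
      have "\<bar>y x ^ k * (1 - y x) ^ m\<bar> \<le> 1" for x
        using y01[of x] by (auto simp: abs_mult intro!: mult_le_one power_le_one)
      then show "AE x in M. norm (y x ^ k * (1 - y x) ^ m * w x) \<le> norm (w x)"
        unfolding real_norm_def abs_mult[of _ "w _"]
        by (intro AE_I2 mult_left_le_one_le abs_ge_zero)
    qed measurable
    have "(\<integral>x. B n (y x) * w x \<partial>M) =
        (\<integral>x. (\<Sum>k\<le>n. g (k / n) * real (n choose k) * (y x ^ k * (1 - y x) ^ (n - k) * w x)) \<partial>M)"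
      by (simp add: B_def Bernstein_def sum_distrib_right mult.assoc)
    then show ?thesis using int by (simp add: Bochner_Integration.integral_sum)
  qed
  ultimately show ?thesis by simp
qed

text \<open>The right side is the \<open>m\<close>-th alternating difference of the moment sequence
  at \<open>k\<close>, as in the Hausdorff moment problem.\<close>

lemma integral_power_one_minus_power:
  fixes y w :: "'b \<Rightarrow> real"
  assumes y [measurable]: "y \<in> borel_measurable M" and w: "integrable M w"
    and y01: "\<And>x. 0 \<le> y x" "\<And>x. y x \<le> 1"
  shows "(\<integral>x. y x ^ k * (1 - y x) ^ m * w x \<partial>M) =
    (\<Sum>j\<le>m. (- 1) ^ j * real (m choose j) * (\<integral>x. y x ^ (k + j) * w x \<partial>M))"
proof -
  have [measurable]: "w \<in> borel_measurable M" using w by simp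
  have int: "integrable M (\<lambda>x. y x ^ j * w x)" for j
  proof (rule Bochner_Integration.integrable_bound[OF w])
    show "AE x in M. norm (y x ^ j * w x) \<le> norm (w x)"
      using y01 by (intro AE_I2) (auto simp: abs_mult power_le_one intro!: mult_left_le_one_le)
  qed measurable
  have "(\<integral>x. y x ^ k * (1 - y x) ^ m * w x \<partial>M) =
      (\<integral>x. (\<Sum>j\<le>m. (- 1) ^ j * real (m choose j) * (y x ^ (k + j) * w x)) \<partial>M)"
  proof (rule Bochner_Integration.integral_cong[OF refl])
    fix x
    have "(1 - y x) ^ m = (\<Sum>j\<le>m. real (m choose j) * (- y x) ^ j * 1 ^ (m - j))"
      using binomial_ring[of "- y x" 1 m] by (simp add: add.commute)
    also have "\<dots> = (\<Sum>j\<le>m. (- 1) ^ j * real (m choose j) * y x ^ j)"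
      by (intro sum.cong refl) (simp add: power_minus[of "y x"] mult_ac)
    finally show "y x ^ k * (1 - y x) ^ m * w x =
        (\<Sum>j\<le>m. (- 1) ^ j * real (m choose j) * (y x ^ (k + j) * w x))"
      by (simp add: sum_distrib_left sum_distrib_right power_add mult_ac)
  qed
  also have "\<dots> = (\<Sum>j\<le>m. (- 1) ^ j * real (m choose j) * (\<integral>x. y x ^ (k + j) * w x \<partial>M))"
    using int by (simp add: Bochner_Integration.integral_sum)
  finally show ?thesis .
qed

text \<open>Equal moments give equal Bernstein approximations. Two different spaces are allowed so
  that a pair of variables can be compared with a single one in \<open>stability\<close>.\<close>

lemma integral_eq_if_power_moments_eq:
  fixes y w :: "'b \<Rightarrow> real" and y' w' :: "'c \<Rightarrow> real"
  assumes "y \<in> borel_measurable M" "integrable M w" "\<And>x. 0 \<le> y x" "\<And>x. y x \<le> 1"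
    and "y' \<in> borel_measurable M'" "integrable M' w'" "\<And>x. 0 \<le> y' x" "\<And>x. y' x \<le> 1"
    and eq: "\<And>k. (\<integral>x. y x ^ k * w x \<partial>M) = (\<integral>x. y' x ^ k * w' x \<partial>M')"
    and g: "continuous_on {0..1} g"
  shows "(\<integral>x. g (y x) * w x \<partial>M) = (\<integral>x. g (y' x) * w' x \<partial>M')"
proof (rule LIMSEQ_unique)
  have "(\<integral>x. y x ^ k * (1 - y x) ^ m * w x \<partial>M) = (\<integral>x. y' x ^ k * (1 - y' x) ^ m * w' x \<partial>M')"
    for k m
    using assms(1-8) by (simp add: integral_power_one_minus_power eq)
  then show "(\<lambda>n. \<Sum>k\<le>n. g (k / n) * real (n choose k) * (\<integral>x. y x ^ k * (1 - y x) ^ (n - k) * w x \<partial>M))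
    \<longlonglongrightarrow> (\<integral>x. g (y' x) * w' x \<partial>M')"
    using Bernstein_integral_tendsto[OF assms(5-8) g] by simp
qed (rule Bernstein_integral_tendsto[OF assms(1-4) g])

text \<open>The factor \<open>v\<close> makes the substitution \<open>v = exp (- u)\<close> continuous at \<open>u = \<infinity>\<close>
  for every bounded \<open>h\<close>.\<close>

lemma continuous_on_times_comp_ln:
  fixes h :: "real \<Rightarrow> real"
  assumes h: "continuous_on UNIV h" and bound: "\<And>u. \<bar>h u\<bar> \<le> C"
  shows "continuous_on {0..1} (\<lambda>v. v * h (- ln v))"
proof -
  have "((\<lambda>v. v * h (- ln v)) \<longlongrightarrow> v * h (- ln v)) (at v within {0..1})" if "v \<in> {0..1}" for v
  proof (cases "v = 0")
    case True
    have "((\<lambda>v. \<bar>v\<bar> * C) \<longlongrightarrow> \<bar>0\<bar> * C) (at 0 within {0..1})"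
      by (intro tendsto_intros)
    then have "((\<lambda>v. v * h (- ln v)) \<longlongrightarrow> 0) (at 0 within {0..1})"
      by (rule Lim_null_comparison[of _ "\<lambda>v. \<bar>v\<bar> * C", rotated, OF tendsto_eq_rhs])
        (auto simp: abs_mult intro!: always_eventually mult_left_mono bound)
    then show ?thesis using True by simp
  next
    case False
    have "isCont h (- ln v)" using h by (simp add: continuous_on_eq_continuous_at)
    then have "isCont (\<lambda>v. v * h (- ln v)) v"
      using False by (intro continuous_intros isCont_o2[of _ "\<lambda>v. - ln v" h]) auto
    then show ?thesis
      unfolding isCont_def by (rule tendsto_within_subset) simp
  qed
  then show ?thesis by (simp add: continuous_on_def)
qed

text \<open>The indicator of the set where \<open>f\<close> is negative is an almost everywhere
  limit of continuous test functions, so \<open>f\<close> has nonnegative integral over that set,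
  which must then be null.\<close>

lemma nonneg_AE_if_integral_continuous_nonneg:
  fixes f :: "real \<Rightarrow> real"
  assumes f: "integrable lborel f"
    and nonneg: "\<And>h. continuous_on UNIV h \<Longrightarrow> (\<And>u. 0 \<le> h u) \<Longrightarrow> (\<And>u. h u \<le> 1) \<Longrightarrow>
      0 \<le> (\<integral>u. h u * f u \<partial>lborel)"
  shows "AE u in lborel. 0 \<le> f u"
proof -
  have [measurable]: "f \<in> borel_measurable borel" using f by simp
  define A where "A = {u. f u < 0}"
  have [measurable]: "A \<in> sets borel" unfolding A_def by measurable
  have "(indicator A :: real \<Rightarrow> real) measurable_on UNIV"
    by (rule lebesgue_measurable_imp_measurable_on_real) (auto intro!: measurable_completion)
  then obtain N g where N: "negligible N" and g: "\<And>n::nat. continuous_on UNIV (g n)"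
    and lim: "\<And>u. u \<notin> N \<Longrightarrow> (\<lambda>n. g n u) \<longlonglongrightarrow> (indicator A u :: real)"
    unfolding measurable_on_def by auto
  \<comment> \<open>Clamping to the unit interval preserves the limit and provides the domination by
    \<open>\<bar>f u\<bar>\<close>.\<close>
  define h where "h n u = max 0 (min 1 (g n u))" for n u
  have h: "continuous_on UNIV (h n)" for n
    unfolding h_def by (intro continuous_intros g)
  have h_lim: "(\<lambda>n. h n u) \<longlonglongrightarrow> indicator A u" if "u \<notin> N" for u
  proof -
    have "(\<lambda>n. h n u) \<longlonglongrightarrow> max 0 (min 1 (indicator A u))"
      unfolding h_def by (intro tendsto_intros lim that)
    then show ?thesis by (simp split: split_indicator_asm)
  qed
  have "AE u in lebesgue. u \<notin> N"
    using N by (intro AE_not_in) (simp add: negligible_iff_null_sets)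
  then have AE: "AE u in lborel. u \<notin> N" by (simp add: AE_completion_iff)
  have [measurable]: "h n \<in> borel_measurable borel" for n
    using h by (rule borel_measurable_continuous_onI)
  have "(\<lambda>n. \<integral>u. h n u * f u \<partial>lborel) \<longlonglongrightarrow> (\<integral>u. indicator A u * f u \<partial>lborel)"
  proof (rule integral_dominated_convergence[where w="\<lambda>u. \<bar>f u\<bar>"])
    show "AE u in lborel. (\<lambda>n. h n u * f u) \<longlonglongrightarrow> indicator A u * f u"
      using AE by eventually_elim (intro tendsto_mult h_lim tendsto_const)
    show "AE u in lborel. norm (h n u * f u) \<le> \<bar>f u\<bar>" for n
      by (intro AE_I2) (auto simp: abs_mult h_def intro!: mult_left_le_one_le)
  qed (use f in auto)
  then have "0 \<le> (\<integral>u. indicator A u * f u \<partial>lborel)"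
    by (rule LIMSEQ_le_const) (intro exI[of _ 0] allI impI nonneg h; simp add: h_def)
  moreover have int: "integrable lborel (\<lambda>u. - (indicator A u * f u))"
    using integrable_mult_indicator[OF _ f, of A] by simp
  have pos: "AE u in lborel. 0 \<le> - (indicator A u * f u)"
    by (auto simp: A_def indicator_def)
  ultimately have "(\<integral>u. - (indicator A u * f u) \<partial>lborel) = 0"
    using integral_nonneg_AE[OF pos] by simp
  then have "AE u in lborel. - (indicator A u * f u) = 0"
    using integral_nonneg_eq_0_iff_AE[OF int pos] by simp
  then show ?thesis
    by eventually_elim (auto simp: A_def indicator_def split: if_splits)
qed

text \<open>The positivity part of the Bernstein-Hausdorff theorem for a given density: in the
  variable \<open>v = exp (- u)\<close> the hypothesis says that all Bernstein weights integrate to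
  nonnegative numbers, so every nonnegative test function does as well.\<close>

lemma laplace_nonneg_AE:
  fixes f :: "real \<Rightarrow> real"
  assumes f: "integrable lborel f" and f0: "\<And>u. u \<le> 0 \<Longrightarrow> f u = 0"
    and diff: "\<And>k m. 0 \<le> (\<Sum>j\<le>m. (- 1) ^ j * real (m choose j) *
      (\<integral>u. exp (- (real (Suc k + j) * u)) * f u \<partial>lborel))"
  shows "AE u in lborel. 0 \<le> f u"
proof -
  have [measurable]: "f \<in> borel_measurable borel" using f by simp
  \<comment> \<open>The absolute value keeps \<open>y\<close> in the unit interval everywhere and is
    harmless because \<open>f\<close> vanishes for \<open>u \<le> 0\<close>.\<close>
  define y :: "real \<Rightarrow> real" where "y u = exp (- \<bar>u\<bar>)" for u
  have y: "y \<in> borel_measurable lborel" "0 \<le> y u" "0 < y u" "y u \<le> 1" for u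
    by (auto simp: y_def [abs_def])
  note [measurable] = y(1)
  have y_eq: "y u * f u = exp (- u) * f u" for u
    using f0[of u] by (cases "u \<le> 0") (auto simp: y_def)
  \<comment> \<open>This factor \<open>y\<close> shifts the moments to the positive arguments
    \<open>Suc k\<close> of the hypothesis. A second one comes from the test function
    \<open>v * h (- ln v)\<close>.\<close>
  have int: "integrable lborel (\<lambda>u. y u * f u)"
    using y by (intro Bochner_Integration.integrable_bound[OF f])
      (auto simp: abs_mult intro!: mult_left_le_one_le)
  have int2: "integrable lborel (\<lambda>u. y u * (y u * f u))"
    using y by (intro Bochner_Integration.integrable_bound[OF int])
      (auto simp: abs_mult intro!: mult_left_le_one_le)
  have power: "y u ^ k * (y u * f u) = exp (- (real (Suc k) * u)) * f u" for k u
  proof (induction k)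
    case (Suc k)
    have "y u ^ Suc k * (y u * f u) = y u * (y u ^ k * (y u * f u))" by simp
    also have "\<dots> = y u * (exp (- (real (Suc k) * u)) * f u)" by (simp only: Suc)
    also have "\<dots> = exp (- (real (Suc k) * u)) * (y u * f u)" by simp
    also have "\<dots> = exp (- (real (Suc (Suc k)) * u)) * f u"
      unfolding y_eq by (simp add: mult_exp_exp algebra_simps)
    finally show ?case .
  qed (simp add: y_eq)
  have bern: "0 \<le> (\<integral>u. y u ^ k * (1 - y u) ^ m * (y u * f u) \<partial>lborel)" for k m
    unfolding integral_power_one_minus_power[OF y(1) int y(2,4)] power
    using diff[of m k] by simp
  have weighted: "0 \<le> (\<integral>u. h u * (y u * (y u * f u)) \<partial>lborel)"
    if "continuous_on UNIV h" "\<And>u. 0 \<le> h u" "\<And>u. h u \<le> 1" for h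
  proof -
    have cont: "continuous_on {0..1} (\<lambda>v. v * h (- ln v))"
      by (rule continuous_on_times_comp_ln[of _ 1]) (use that in auto)
    have "0 \<le> (\<integral>u. y u * h (- ln (y u)) * (y u * f u) \<partial>lborel)"
      by (rule LIMSEQ_le_const[OF Bernstein_integral_tendsto[OF y(1) int y(2,4) cont]])
        (intro exI[of _ 0] allI impI sum_nonneg mult_nonneg_nonneg bern that; simp)
    also have "(\<lambda>u. y u * h (- ln (y u)) * (y u * f u)) = (\<lambda>u. h u * (y u * (y u * f u)))"
    proof
      fix u show "y u * h (- ln (y u)) * (y u * f u) = h u * (y u * (y u * f u))"
        using f0[of u] by (cases "u \<le> 0") (auto simp: y_def)
    qed
    finally show ?thesis .
  qed
  have "AE u in lborel. 0 \<le> y u * (y u * f u)"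
    by (rule nonneg_AE_if_integral_continuous_nonneg[OF int2]) (rule weighted)
  then show ?thesis
  proof eventually_elim
    case (elim u)
    then show ?case using y(3)[of u] by (auto simp: zero_le_mult_iff)
  qed
qed

text \<open>A vanishing transform satisfies the sign criterion for \<open>f\<close> and for
  \<open>- f\<close>.\<close>

lemma laplace_zero_AE:
  fixes f :: "real \<Rightarrow> real"
  assumes f: "integrable lborel f" and f0: "\<And>u. u \<le> 0 \<Longrightarrow> f u = 0"
    and zero: "\<And>l. 0 \<le> l \<Longrightarrow> (\<integral>u. exp (- (l * u)) * f u \<partial>lborel) = 0"
  shows "AE u in lborel. f u = 0"
proof -
  have zero': "(\<integral>u. exp (- (real n * u)) * f u \<partial>lborel) = 0" for n
    using zero[of "real n"] by simp
  have "AE u in lborel. 0 \<le> f u"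
    by (rule laplace_nonneg_AE[OF f f0]) (simp_all only: zero' mult_zero_right sum.neutral_const order_refl)
  moreover have "AE u in lborel. 0 \<le> - f u"
  proof (rule laplace_nonneg_AE)
    have "(\<integral>u. exp (- (real n * u)) * - f u \<partial>lborel) = 0" for n
      using zero'[of n] by simp
    then show "0 \<le> (\<Sum>j\<le>m. (- 1) ^ j * real (m choose j) *
      (\<integral>u. exp (- (real (Suc k + j) * u)) * - f u \<partial>lborel))" for k m
      by (simp only: mult_zero_right sum.neutral_const order_refl)
  qed (use f f0 in auto)
  ultimately show ?thesis by eventually_elim simp
qed

section \<open>Complete monotonicity of \<open>exp (- (x powr \<beta>))\<close>\<close>

text \<open>\<open>G n\<close> plays the role of \<open>(- 1) ^ n\<close> times the
  \<open>n\<close>-th derivative of \<open>G 0\<close>. The difference between \<open>x\<close> and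
  \<open>x + 1\<close> inherits both hypotheses, and it lowers the order \<open>m\<close> by
  one.\<close>

lemma alternating_differences_nonneg:
  fixes G :: "nat \<Rightarrow> real \<Rightarrow> real" and x :: real
  assumes "\<And>n x. 0 < x \<Longrightarrow> 0 \<le> G n x"
    and "\<And>n x. 0 < x \<Longrightarrow> (G n has_real_derivative - G (Suc n) x) (at x)"
    and "0 < x"
  shows "0 \<le> (\<Sum>j\<le>m. (- 1) ^ j * real (m choose j) * G 0 (x + j))"
  using assms
proof (induction m arbitrary: G x)
  case (Suc m)
  define H where "H n x = G n x - G n (x + 1)" for n x
  have "0 \<le> H n x" if "0 < x" for n x
  proof -
    have "G n (x + 1) \<le> G n x"
    proof (rule DERIV_nonpos_imp_nonincreasing[of x "x + 1" "G n"])
      fix z assume "x \<le> z"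
      then have "0 < z" using that by simp
      then show "\<exists>y. (G n has_real_derivative y) (at z) \<and> y \<le> 0"
        using Suc.prems(1)[of z "Suc n"] Suc.prems(2)[of z n] by auto
    qed simp
    then show ?thesis by (simp add: H_def)
  qed
  moreover have "(H n has_real_derivative - H (Suc n) x) (at x)" if "0 < x" for n x
  proof -
    have "((\<lambda>x. G n (x + 1)) has_real_derivative - G (Suc n) (x + 1)) (at x)"
      using DERIV_shift[of "G n" _ x 1] Suc.prems(2)[of "x + 1" n] that by simp
    then show ?thesis
      unfolding H_def using Suc.prems(2)[OF that, of n]
      by (auto intro!: derivative_eq_intros simp: H_def)
  qed
  ultimately have "0 \<le> (\<Sum>j\<le>m. (- 1) ^ j * real (m choose j) * H 0 (x + j))"
    using Suc.IH[of H x] Suc.prems(3) by blast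
  define a where "a j = (- 1) ^ j * G 0 (x + j)" for j :: nat
  have "(\<Sum>j\<le>Suc m. real (Suc m choose j) * a j) =
      a 0 + (\<Sum>j\<le>m. real (Suc m choose Suc j) * a (Suc j))"
    by (simp only: sum.atMost_Suc_shift) simp
  also have "\<dots> = (a 0 + (\<Sum>j\<le>m. real (m choose Suc j) * a (Suc j))) + (\<Sum>j\<le>m. real (m choose j) * a (Suc j))"
    by (simp add: sum.distrib distrib_right)
  also have "a 0 + (\<Sum>j\<le>m. real (m choose Suc j) * a (Suc j)) = (\<Sum>j\<le>Suc m. real (m choose j) * a j)"
    by (simp only: sum.atMost_Suc_shift) simp
  also have "\<dots> = (\<Sum>j\<le>m. real (m choose j) * a j)" by simp
  also have "\<dots> + (\<Sum>j\<le>m. real (m choose j) * a (Suc j)) =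
      (\<Sum>j\<le>m. (- 1) ^ j * real (m choose j) * H 0 (x + j))"
    unfolding sum.distrib[symmetric] by (intro sum.cong refl) (simp add: a_def H_def algebra_simps)
  finally show ?case using \<open>0 \<le> (\<Sum>j\<le>m. (- 1) ^ j * real (m choose j) * H 0 (x + j))\<close>
    by (simp add: a_def mult_ac)
qed simp

text \<open>If \<open>\<phi>\<close> has derivative \<open>- (a 0 * \<phi>)\<close> and
  \<open>a n\<close> are the derivatives of \<open>a 0\<close> with alternating signs, these are the
  derivatives of \<open>\<phi>\<close> with alternating signs, by the Leibniz rule. The recursion
  contains no minus sign, so positivity is visible.\<close>

fun leibniz_iterates :: "(nat \<Rightarrow> real \<Rightarrow> real) \<Rightarrow> (real \<Rightarrow> real) \<Rightarrow> nat \<Rightarrow> real \<Rightarrow> real" where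
  "leibniz_iterates a \<phi> 0 x = \<phi> x"
| "leibniz_iterates a \<phi> (Suc n) x = (\<Sum>k\<le>n. real (n choose k) * a k x * leibniz_iterates a \<phi> (n - k) x)"

lemma leibniz_iterates_nonneg:
  assumes "\<And>n. 0 \<le> a n x" "0 \<le> \<phi> x"
  shows "0 \<le> leibniz_iterates a \<phi> n x"
proof (induction n rule: less_induct)
  case (less n)
  then show ?case using assms by (cases n) (auto intro!: sum_nonneg mult_nonneg_nonneg)
qed

text \<open>The product rule acts on each term and Pascal's rule recombines them. The induction is
  strong because each iterate refers to all earlier ones.\<close>

lemma leibniz_iterates_deriv:
  assumes a: "\<And>n. (a n has_real_derivative - a (Suc n) x) (at x)"
    and \<phi>: "(\<phi> has_real_derivative - (a 0 x * \<phi> x)) (at x)"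
  shows "(leibniz_iterates a \<phi> n has_real_derivative - leibniz_iterates a \<phi> (Suc n) x) (at x)"
proof (induction n rule: less_induct)
  case (less n)
  show ?case
  proof (cases n)
    case 0
    moreover have "leibniz_iterates a \<phi> 0 = \<phi>" by (simp add: fun_eq_iff)
    ultimately show ?thesis using \<phi> by simp
  next
    case (Suc m)
    let ?G = "leibniz_iterates a \<phi>"
    define b where "b k = a k x * ?G (Suc m - k) x" for k
    have "((\<lambda>x. \<Sum>k\<le>m. real (m choose k) * a k x * ?G (m - k) x) has_real_derivative
        (\<Sum>k\<le>m. real (m choose k) * (- a (Suc k) x) * ?G (m - k) x +
          - ?G (Suc (m - k)) x * (real (m choose k) * a k x))) (at x)"
      using Suc by (intro DERIV_sum DERIV_mult DERIV_cmult a less) auto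
    also have "(\<Sum>k\<le>m. real (m choose k) * (- a (Suc k) x) * ?G (m - k) x +
          - ?G (Suc (m - k)) x * (real (m choose k) * a k x)) =
        - ((\<Sum>k\<le>m. real (m choose k) * b k) + (\<Sum>k\<le>m. real (m choose k) * b (Suc k)))"
      unfolding sum.distrib[symmetric] sum_negf[symmetric]
      by (intro sum.cong refl) (simp add: b_def Suc_diff_le algebra_simps del: leibniz_iterates.simps)
    also have "(\<Sum>k\<le>m. real (m choose k) * b k) = (\<Sum>k\<le>Suc m. real (m choose k) * b k)" by simp
    also have "\<dots> = b 0 + (\<Sum>k\<le>m. real (m choose Suc k) * b (Suc k))"
      by (simp only: sum.atMost_Suc_shift) simp
    also have "\<dots> + (\<Sum>k\<le>m. real (m choose k) * b (Suc k)) =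
        b 0 + (\<Sum>k\<le>m. real (Suc m choose Suc k) * b (Suc k))"
      by (simp add: sum.distrib distrib_right)
    also have "\<dots> = (\<Sum>k\<le>Suc m. real (Suc m choose k) * b k)"
      by (simp only: sum.atMost_Suc_shift) simp
    also have "\<dots> = ?G (Suc n) x"
      unfolding Suc leibniz_iterates.simps(2)[of _ _ "Suc m"] by (simp add: b_def mult.assoc del: leibniz_iterates.simps sum.atMost_Suc)
    finally show ?thesis unfolding Suc leibniz_iterates.simps(2)[of _ _ m, abs_def] .
  qed
qed

lemma exp_minus_powr_differences_nonneg:
  fixes \<beta> :: real
  assumes \<beta>: "0 < \<beta>" "\<beta> < 1" and x: "0 < x"
  shows "0 \<le> (\<Sum>j\<le>m. (- 1) ^ j * real (m choose j) * exp (- ((x + real j) powr \<beta>)))"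
proof -
  \<comment> \<open>Up to the sign \<open>(- 1) ^ n\<close>, the \<open>n\<close>-th derivative of
    \<open>\<beta> * x powr (\<beta> - 1)\<close>; the Pochhammer factors are positive because
    \<open>\<beta> < 1\<close>.\<close>
  define a where "a n x = \<beta> * pochhammer (1 - \<beta>) n * x powr (\<beta> - 1 - real n)" for n x
  define \<phi> where "\<phi> x = exp (- (x powr \<beta>))" for x :: real
  have a: "(a n has_real_derivative - a (Suc n) x) (at x)" if "0 < x" for n x
  proof -
    have "(a n has_real_derivative
        \<beta> * pochhammer (1 - \<beta>) n * ((\<beta> - 1 - real n) * x powr (\<beta> - 1 - real n - 1))) (at x)"
      unfolding a_def using that by (intro DERIV_cmult has_real_derivative_powr)
    then show ?thesis by (rule DERIV_cong) (simp add: a_def pochhammer_Suc algebra_simps)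
  qed
  have \<phi>: "(\<phi> has_real_derivative - (a 0 x * \<phi> x)) (at x)" if "0 < x" for x
    unfolding \<phi>_def a_def using that
    by (auto intro!: derivative_eq_intros)
  have "0 \<le> (\<Sum>j\<le>m. (- 1) ^ j * real (m choose j) * leibniz_iterates a \<phi> 0 (x + j))"
  proof (rule alternating_differences_nonneg[OF _ _ x])
    show "0 \<le> leibniz_iterates a \<phi> n x" if "0 < x" for n x
      using \<beta> by (intro leibniz_iterates_nonneg)
        (auto simp: a_def \<phi>_def intro!: mult_nonneg_nonneg pochhammer_nonneg)
    show "(leibniz_iterates a \<phi> n has_real_derivative - leibniz_iterates a \<phi> (Suc n) x) (at x)"
      if "0 < x" for n x
      using leibniz_iterates_deriv[of a x \<phi> n] a \<phi> that by blast
  qed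
  then show ?thesis by (simp add: \<phi>_def)
qed

section \<open>The support of a stable law\<close>

locale stable_law = prob_space M for M :: "real measure" +
  fixes \<beta> :: real
  assumes \<beta>: "0 < \<beta>" "\<beta> < 1"
    and sets_M [measurable_cong]: "sets M = sets borel"
    and pos_AE: "AE u in M. 0 < u"
    and laplace: "\<And>l. 0 \<le> l \<Longrightarrow> (\<integral>u. exp (- (l * u)) \<partial>M) = exp (- (l powr \<beta>))"
begin

lemma space_M [simp]: "space M = UNIV"
  using sets_eq_imp_space_eq[OF sets_M] by simp

text \<open>The absolute value changes nothing almost everywhere but bounds the exponential by one
  at every point, as the moment lemmas require.\<close>

lemma laplace_abs:
  assumes "0 \<le> l" shows "(\<integral>u. exp (- (l * \<bar>u\<bar>)) \<partial>M) = exp (- (l powr \<beta>))"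
  unfolding laplace[OF assms, symmetric]
  by (rule integral_cong_AE) (auto intro!: eventually_mono[OF pos_AE])

text \<open>By independence, \<open>exp (- (a * U + b * V))\<close> and \<open>exp (- U)\<close>
  have the same moments. The exponential weight in the conclusion is the factor \<open>v\<close> of
  \<open>continuous_on_times_comp_ln\<close>.\<close>

lemma stability:
  assumes ab: "0 \<le> a" "0 \<le> b" "a powr \<beta> + b powr \<beta> = 1"
    and h: "continuous_on UNIV h" "\<And>u. \<bar>h u\<bar> \<le> C"
  shows "(\<integral>p. exp (- (a * \<bar>fst p\<bar> + b * \<bar>snd p\<bar>)) * h (a * \<bar>fst p\<bar> + b * \<bar>snd p\<bar>) \<partial>(M \<Otimes>\<^sub>M M)) =
    (\<integral>u. exp (- \<bar>u\<bar>) * h \<bar>u\<bar> \<partial>M)"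
proof -
  interpret MM: pair_prob_space M M ..
  define y where "y p = exp (- (a * \<bar>fst p\<bar> + b * \<bar>snd p\<bar>))" for p :: "real \<times> real"
  define y' where "y' u = exp (- \<bar>u\<bar>)" for u :: real
  have arg: "0 \<le> a * \<bar>fst p\<bar> + b * \<bar>snd p\<bar>" for p :: "real \<times> real"
    using ab by simp
  have y: "y \<in> borel_measurable (M \<Otimes>\<^sub>M M)" "0 \<le> y p" "y p \<le> 1" for p
    using arg[of p] unfolding y_def[abs_def] by auto
  have y': "y' \<in> borel_measurable M" "0 \<le> y' u" "y' u \<le> 1" for u
    unfolding y'_def[abs_def] by auto
  have moments: "(\<integral>p. y p ^ k * 1 \<partial>(M \<Otimes>\<^sub>M M)) = (\<integral>u. y' u ^ k * 1 \<partial>M)" for k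
  proof -
    have "integrable (M \<Otimes>\<^sub>M M) (\<lambda>p. y p ^ k)"
      using y by (intro MM.P.integrable_const_bound[of _ 1]) (auto simp: power_le_one)
    then have "(\<integral>p. y p ^ k \<partial>(M \<Otimes>\<^sub>M M)) = (\<integral>u. (\<integral>v. y (u, v) ^ k \<partial>M) \<partial>M)"
      by (rule MM.integral_fst'[symmetric])
    also have "\<dots> = (\<integral>u. (\<integral>v. exp (- (real k * a * \<bar>u\<bar>)) * exp (- (real k * b * \<bar>v\<bar>)) \<partial>M) \<partial>M)"
      unfolding y_def by (simp add: exp_of_nat_mult[symmetric] mult_exp_exp algebra_simps)
    also have "\<dots> = exp (- ((real k * a) powr \<beta>)) * exp (- ((real k * b) powr \<beta>))"
      using ab by (simp add: laplace_abs)
    also have "\<dots> = exp (- (real k powr \<beta> * (a powr \<beta> + b powr \<beta>)))"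
      using ab(1,2) by (simp add: powr_mult mult_exp_exp algebra_simps)
    also have "\<dots> = (\<integral>u. exp (- (real k * \<bar>u\<bar>)) \<partial>M)"
      by (simp add: ab laplace_abs)
    also have "\<dots> = (\<integral>u. y' u ^ k \<partial>M)"
      by (simp add: y'_def exp_of_nat_mult[symmetric])
    finally show ?thesis by simp
  qed
  show ?thesis
    using integral_eq_if_power_moments_eq[OF y(1) MM.P.integrable_const y(2,3) y'(1)
        integrable_const y'(2,3) moments continuous_on_times_comp_ln[OF h]]
    by (simp only: y_def y'_def ln_exp minus_minus mult_1_right)
qed

section \<open>Dilations of the topological support\<close>

definition support :: "real set" where
  "support = {x. \<forall>e>0. 0 < prob (ball x e)}"

text \<open>Two independent copies are both near \<open>x\<close> with positive probability, which
  puts \<open>a * U + b * V\<close> near \<open>(a + b) * x\<close>. A tent function there would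
  have integral zero if that point were outside the support.\<close>

lemma support_stable:
  assumes x: "x \<in> support" "0 \<le> x"
    and ab: "0 \<le> a" "0 \<le> b" "a powr \<beta> + b powr \<beta> = 1"
  shows "(a + b) * x \<in> support"
proof (rule ccontr)
  interpret MM: pair_prob_space M M ..
  define z where "z = (a + b) * x"
  assume "(a + b) * x \<notin> support"
  then obtain e where e: "0 < e" "prob (ball z e) = 0"
    unfolding support_def z_def using zero_less_measure_iff by fastforce
  define h where "h u = max 0 (e - \<bar>u - z\<bar>)" for u
  have h: "continuous_on UNIV h" "\<bar>h u\<bar> \<le> e" "0 \<le> h u" for u
    unfolding h_def using e(1) by (auto intro!: continuous_intros)
  have [measurable]: "h \<in> borel_measurable borel"
    using h(1) by (rule borel_measurable_continuous_onI)
  define F where "F p = exp (- (a * \<bar>fst p\<bar> + b * \<bar>snd p\<bar>)) * h (a * \<bar>fst p\<bar> + b * \<bar>snd p\<bar>)"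
    for p :: "real \<times> real"
  have "AE u in M. u \<notin> ball z e"
    using e(2) by (intro AE_not_in) (simp add: null_sets_def emeasure_eq_measure)
  with pos_AE have "AE u in M. exp (- \<bar>u\<bar>) * h \<bar>u\<bar> = 0"
    by eventually_elim (auto simp: h_def dist_real_def)
  then have "(\<integral>u. exp (- \<bar>u\<bar>) * h \<bar>u\<bar> \<partial>M) = 0"
    by (intro integral_eq_zero_AE)
  then have F0: "(\<integral>p. F p \<partial>(M \<Otimes>\<^sub>M M)) = 0"
    unfolding F_def stability[OF ab h(1,2)] .
  have F_le: "\<bar>F p\<bar> \<le> e" for p
  proof -
    have "\<bar>F p\<bar> \<le> \<bar>h (a * \<bar>fst p\<bar> + b * \<bar>snd p\<bar>)\<bar>"
      unfolding F_def abs_mult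
      using mult_nonneg_nonneg[OF ab(1), of "\<bar>fst p\<bar>"] mult_nonneg_nonneg[OF ab(2), of "\<bar>snd p\<bar>"]
      by (intro mult_left_le_one_le) auto
    then show ?thesis using h(2) order_trans by blast
  qed
  have [measurable]: "F \<in> borel_measurable (M \<Otimes>\<^sub>M M)" unfolding F_def[abs_def] by measurable
  have "integrable (M \<Otimes>\<^sub>M M) F"
    using F_le by (intro MM.P.integrable_const_bound[of _ e]) auto
  moreover have "AE p in M \<Otimes>\<^sub>M M. 0 \<le> F p" using h(3) by (simp add: F_def)
  ultimately have AE: "AE p in M \<Otimes>\<^sub>M M. F p = 0"
    using F0 integral_nonneg_eq_0_iff_AE by blast
  \<comment> \<open>As \<open>a\<close> and \<open>b\<close> are at most one, two deviations of
    \<open>e / 4\<close> add up to at most \<open>e / 2\<close>, inside the tent.\<close>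
  define B where "B = ball x (e / 4)"
  have [measurable]: "B \<in> sets M" unfolding B_def sets_M by simp
  have a1: "a \<le> 1" and b1: "b \<le> 1"
    using ab \<beta> by (smt (verit) powr_ge_zero powr_less_mono2 powr_one_eq_one)+
  have nz: "F p \<noteq> 0" if "p \<in> B \<times> B" for p
  proof -
    have d: "\<bar>\<bar>fst p\<bar> - x\<bar> \<le> e / 4" "\<bar>\<bar>snd p\<bar> - x\<bar> \<le> e / 4"
      using that x(2) by (auto simp: B_def dist_real_def abs_if split: if_splits)
    have "\<bar>a * \<bar>fst p\<bar> + b * \<bar>snd p\<bar> - z\<bar> = \<bar>a * (\<bar>fst p\<bar> - x) + b * (\<bar>snd p\<bar> - x)\<bar>"
      by (simp add: z_def algebra_simps)
    also have "\<dots> \<le> a * \<bar>\<bar>fst p\<bar> - x\<bar> + b * \<bar>\<bar>snd p\<bar> - x\<bar>"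
      using ab by (intro order_trans[OF abs_triangle_ineq]) (simp add: abs_mult)
    also have "\<dots> \<le> 1 * (e / 4) + 1 * (e / 4)"
      using a1 b1 d ab by (intro add_mono mult_mono) auto
    also have "\<dots> < e" using e(1) by simp
    finally show ?thesis by (simp add: F_def h_def)
  qed
  have "AE p in M \<Otimes>\<^sub>M M. p \<notin> B \<times> B"
    using AE by eventually_elim (use nz in blast)
  then have "emeasure (M \<Otimes>\<^sub>M M) (B \<times> B) = 0"
    by (subst (asm) AE_iff_measurable[OF _ refl]) (auto simp: space_pair_measure)
  moreover have "emeasure (M \<Otimes>\<^sub>M M) (B \<times> B) = emeasure M B * emeasure M B"
    by (rule emeasure_pair_measure_Times) auto
  ultimately have "prob B = 0" by (simp add: emeasure_eq_measure)
  moreover have "0 < prob B" using x(1) e(1) by (simp add: support_def B_def)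
  ultimately show False by simp
qed

text \<open>By the intermediate value theorem the factors \<open>a + b\<close> fill an interval from
  \<open>r\<close> to \<open>1\<close>, where \<open>r < 1\<close> because
  \<open>1 / \<beta> > 1\<close>. Iteration extends it down to \<open>r ^ n\<close>.\<close>

lemma support_scale:
  assumes x: "x \<in> support" "0 \<le> x" and c: "0 < c" "c \<le> 1"
  shows "c * x \<in> support"
proof -
  define g where "g p = p powr (1 / \<beta>) + (1 - p) powr (1 / \<beta>)" for p :: real
  define r where "r = g (1 / 2)"
  have b1: "1 < 1 / \<beta>" using \<beta> by simp
  have half: "(1 / 2) powr (1 / \<beta>) < (1 / 2 :: real)"
    using powr_less_mono'[of "1/2" 1 "1/\<beta>"] b1 by simp
  have r: "0 < r" "r < 1" using half by (auto simp: r_def g_def)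
  have step: "c * x \<in> support" if "x \<in> support" "0 \<le> x" "r \<le> c" "c \<le> 1" for c x
  proof -
    have "continuous_on {0..1/2} g"
      unfolding g_def using \<beta> by (intro continuous_intros continuous_on_powr') auto
    moreover have "g 0 = 1" using \<beta> by (simp add: g_def)
    ultimately have "\<exists>p\<ge>0. p \<le> 1/2 \<and> g p = c"
      using IVT2'[of g "1/2" c 0] that by (auto simp: r_def)
    then obtain p where p: "0 \<le> p" "p \<le> 1/2" "g p = c" by blast
    show ?thesis
      using support_stable[OF that(1,2), of "p powr (1 / \<beta>)" "(1 - p) powr (1 / \<beta>)"] p \<beta>
      by (simp add: powr_powr g_def)
  qed
  have "\<forall>c. r ^ n \<le> c \<and> c \<le> 1 \<longrightarrow> c * x \<in> support" for n
  proof (induction n)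
    case 0
    then show ?case using x by (auto dest: antisym)
  next
    case (Suc n)
    show ?case
    proof (intro allI impI)
      fix c assume c: "r ^ Suc n \<le> c \<and> c \<le> 1"
      show "c * x \<in> support"
      proof (cases "r \<le> c")
        case True
        then show ?thesis using step x c by blast
      next
        case False
        then have "r ^ n \<le> c / r \<and> c / r \<le> 1" using c r by (simp add: field_simps)
        then have "(c / r) * x \<in> support" using Suc by blast
        moreover have "0 \<le> (c / r) * x"
          using c r x(2) order_trans[of 0 "r ^ Suc n" c] by simp
        ultimately have "r * ((c / r) * x) \<in> support" using r step[of "(c / r) * x" r] by simp
        then show ?thesis using r by simp
      qed
    qed
  qed
  moreover obtain n where "r ^ n < c" using real_arch_pow_inv[OF c(1) r(2)] by blast
  ultimately show ?thesis using c(2) by (meson less_imp_le)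
qed

text \<open>A law carried by \<open>[0, K]\<close> would satisfy \<open>1 - exp (- (l powr \<beta>)) \<le> K * l\<close>, which fails as
  \<open>l \<rightarrow> 0\<close> because \<open>\<beta> < 1\<close>.\<close>

lemma not_bounded_AE: "\<not> (AE u in M. u \<le> K)"
proof
  assume K: "AE u in M. u \<le> K"
  \<comment> \<open>\<open>l\<close> is chosen so that \<open>l powr \<beta> = C * l\<close>, just
    above the bound \<open>2 * \<bar>K\<bar> * l\<close> derived below; \<open>C \<ge> 1\<close>
    ensures \<open>l \<le> 1\<close>.\<close>
  define C where "C = 2 * \<bar>K\<bar> + 1"
  define l where "l = C powr (- (1 / (1 - \<beta>)))"
  have C: "1 \<le> C" by (simp add: C_def)
  have l: "0 < l" "l \<le> 1"
    using C \<beta> powr_mono[of "- (1 / (1 - \<beta>))" 0 C] by (auto simp: l_def)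
  have "- (1 / (1 - \<beta>)) * (\<beta> - 1) = 1" using \<beta> by (simp add: field_simps)
  then have "l powr (\<beta> - 1) = C"
    using C by (simp only: l_def powr_powr) simp
  then have lC: "l powr \<beta> = C * l"
    using l powr_add[of l "\<beta> - 1" 1] by simp
  have int: "integrable M (\<lambda>u. exp (- (l * \<bar>u\<bar>)))"
    using l by (intro integrable_const_bound[of _ 1]) auto
  have "1 - l * \<bar>K\<bar> = (\<integral>u. 1 - l * \<bar>K\<bar> \<partial>M)" using prob_space by simp
  also have "\<dots> \<le> (\<integral>u. exp (- (l * \<bar>u\<bar>)) \<partial>M)"
  proof (rule integral_mono_AE)
    show "AE u in M. 1 - l * \<bar>K\<bar> \<le> exp (- (l * \<bar>u\<bar>))"
      using K pos_AE
    proof eventually_elim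
      case (elim u)
      then have "l * \<bar>u\<bar> \<le> l * \<bar>K\<bar>" using l by (intro mult_left_mono) auto
      then show ?case using exp_ge_add_one_self[of "- (l * \<bar>u\<bar>)"] by linarith
    qed
  qed (use int in auto)
  also have "\<dots> = exp (- (l powr \<beta>))" using l by (intro laplace_abs) simp
  \<comment> \<open>For \<open>0 \<le> x \<le> 1\<close>,
    \<open>exp (- x) \<le> 1 / (1 + x) \<le> 1 - x / 2\<close>. The halving accounts for the
    \<open>2\<close> in \<open>C\<close>.\<close>
  also have "\<dots> \<le> 1 - l powr \<beta> / 2"
  proof -
    have x: "0 \<le> l powr \<beta>" "l powr \<beta> \<le> 1"
      using l \<beta> by (auto simp: powr_le1)
    have pos: "0 < 1 + l powr \<beta>" using x(1) by linarith
    have "1 + l powr \<beta> \<le> exp (l powr \<beta>)" by (rule exp_ge_add_one_self)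
    then have "exp (- (l powr \<beta>)) \<le> 1 / (1 + l powr \<beta>)"
      using pos frac_le[of 1 1 "1 + l powr \<beta>" "exp (l powr \<beta>)"]
      by (simp add: exp_minus inverse_eq_divide)
    also have "\<dots> \<le> 1 - l powr \<beta> / 2"
    proof -
      have "0 \<le> l powr \<beta> * (1 - l powr \<beta>)" using x by simp
      then have "1 \<le> (1 - l powr \<beta> / 2) * (1 + l powr \<beta>)" by (simp add: algebra_simps)
      then show ?thesis by (simp only: pos_divide_le_eq[OF pos])
    qed
    finally show ?thesis .
  qed
  finally have "C * l \<le> 2 * \<bar>K\<bar> * l" unfolding lC by (simp add: mult_ac)
  then show False using l by (simp add: C_def algebra_simps)
qed

text \<open>Otherwise every point above \<open>K\<close> has a null ball, and by Lindelof countably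
  many of them cover these points, so the law would be bounded.\<close>

lemma support_unbounded: "\<exists>x>K. x \<in> support"
proof (rule ccontr)
  assume "\<not> (\<exists>x>K. x \<in> support)"
  then have null: "\<exists>e>0. prob (ball x e) = 0" if "K < x" for x
    using that unfolding support_def using zero_less_measure_iff by fastforce
  define \<F> where "\<F> = {ball x e |x e. prob (ball x e) = 0}"
  obtain \<G> where \<G>: "\<G> \<subseteq> \<F>" "countable \<G>" "\<Union>\<G> = \<Union>\<F>"
    using Lindelof[of \<F>] unfolding \<F>_def by force
  have "(\<Union>B\<in>\<G>. B) \<in> null_sets M"
    using \<G>(1) by (intro null_sets_UN' \<G>(2))
      (auto simp: \<F>_def null_sets_def emeasure_eq_measure sets_M)
  then have "\<Union>\<F> \<in> null_sets M" using \<G>(3) by simp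
  then have "AE u in M. u \<notin> \<Union>\<F>" by (rule AE_not_in)
  moreover have "u \<in> \<Union>\<F>" if "K < u" for u
    using null[OF that] by (force simp: \<F>_def)
  ultimately have "AE u in M. u \<le> K" by (auto elim!: eventually_mono simp: not_less[symmetric])
  then show False using not_bounded_AE by blast
qed

text \<open>The midpoint is a support point beyond \<open>b\<close> scaled down.\<close>

lemma prob_interval_pos:
  assumes "0 \<le> a" "a < b"
  shows "0 < prob {a<..<b}"
proof -
  obtain x where x: "b < x" "x \<in> support" using support_unbounded by blast
  define z where "z = (a + b) / 2"
  have "(z / x) * x \<in> support"
    using x assms by (intro support_scale) (auto simp: z_def field_simps)
  then have "z \<in> support" using x assms by simp
  then have "0 < prob (ball z ((b - a) / 2))"
    using assms by (auto simp: support_def)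
  also have "ball z ((b - a) / 2) = {a<..<b}"
    by (auto simp: z_def dist_real_def ball_def abs_if field_simps split: if_splits)
  finally show ?thesis .
qed

text \<open>A disjoint interval to the right also has positive mass.\<close>

lemma prob_interval_lt_1:
  assumes "0 \<le> a" "a < b"
  shows "prob {a<..<b} < 1"
proof -
  have "prob {a<..<b} + prob {b<..<b + 1} = prob ({a<..<b} \<union> {b<..<b + 1})"
    by (rule finite_measure_Union[symmetric]) (auto simp: sets_M)
  also have "\<dots> \<le> 1" by (rule prob_le_1)
  finally show ?thesis using prob_interval_pos[of b "b + 1"] assms by simp
qed

text \<open>Bounded intervals away from zero exhaust the half-line that carries the law.\<close>

lemma exists_interval_prob_gt:
  assumes "c < 1"
  shows "\<exists>a b. 0 < a \<and> a < b \<and> c < prob {a<..<b}"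
proof -
  define I where "I n = {1 / (real n + 2) <..< real n + 2}" for n :: nat
  have meas: "range I \<subseteq> sets M" by (auto simp: I_def sets_M)
  have inc: "incseq I"
  proof (rule incseq_SucI)
    show "I n \<le> I (Suc n)" for n
      using frac_le[of 1 1 "real n + 2" "real n + 3"] by (auto simp: I_def add_ac)
  qed
  have "(\<Union>n. I n) = {0<..}"
  proof (intro equalityI subsetI)
    fix u assume "u \<in> (\<Union>n. I n)"
    then obtain n where "1 / (real n + 2) < u" by (auto simp: I_def)
    moreover have "0 < 1 / (real n + 2)" by simp
    ultimately have "0 < u" by (rule less_trans[rotated])
    then show "u \<in> {0<..}" by simp
  next
    fix u :: real assume "u \<in> {0<..}"
    then have u: "0 < u" by simp
    obtain n :: nat where n: "max u (1 / u) < n" using reals_Archimedean2 by blast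
    then have "1 / u < real n + 2" "u < real n + 2" by auto
    then have "u \<in> I n" using u by (auto simp: I_def field_simps)
    then show "u \<in> (\<Union>n. I n)" by blast
  qed
  moreover have "prob {0<..} = 1"
    using pos_AE by (subst prob_eq_1) (auto simp: sets_M)
  ultimately have "(\<lambda>n. prob (I n)) \<longlonglongrightarrow> 1"
    using finite_Lim_measure_incseq[OF meas inc] by simp
  then have "\<forall>\<^sub>F n in sequentially. c < prob (I n)"
    using assms by (rule order_tendstoD)
  then obtain n where n: "c < prob (I n)" by (auto simp: eventually_sequentially)
  have "1 / (real n + 2) < real n + 2"
    by (rule order_less_le_trans[of _ 1]) auto
  with n show ?thesis unfolding I_def
    by (intro exI[of _ "1 / (real n + 2)"] exI[of _ "real n + 2"]) auto
qed

text \<open>The intervals are open at their common left end, so they shrink to the empty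
  set.\<close>

lemma exists_interval_prob_lt:
  assumes "0 < c"
  shows "\<exists>a b. 0 < a \<and> a < b \<and> prob {a<..<b} < c"
proof -
  define I where "I n = {1 <..< 1 + 1 / (real n + 1)}" for n :: nat
  have meas: "range I \<subseteq> sets M" by (auto simp: I_def sets_M)
  have dec: "decseq I"
  proof (rule decseq_SucI)
    show "I (Suc n) \<le> I n" for n
      using frac_le[of 1 1 "real n + 1" "real n + 2"] by (auto simp: I_def add_ac)
  qed
  have "(\<Inter>n. I n) = {}"
  proof (rule ccontr)
    assume "(\<Inter>n. I n) \<noteq> {}"
    then obtain u where u: "\<And>n. u \<in> I n" by blast
    then have "0 < u - 1" using u[of 0] by (simp add: I_def)
    then obtain n :: nat where "inverse (real (Suc n)) < u - 1"
      using reals_Archimedean by blast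
    then show False using u[of n] by (simp add: I_def inverse_eq_divide add_ac)
  qed
  then have "(\<lambda>n. prob (I n)) \<longlonglongrightarrow> 0"
    using finite_Lim_measure_decseq[OF meas dec] by simp
  then have "\<forall>\<^sub>F n in sequentially. prob (I n) < c"
    using assms by (rule order_tendstoD)
  then obtain n where "prob (I n) < c" by (auto simp: eventually_sequentially)
  then show ?thesis unfolding I_def
    by (intro exI[of _ 1] exI[of _ "1 + 1 / (real n + 1)"]) auto
qed

end

section \<open>The stable kernel\<close>

locale stable_family =
  fixes \<alpha> :: real and \<eta> :: "real \<Rightarrow> real \<Rightarrow> real"
  assumes \<alpha>: "0 < \<alpha>" "\<alpha> < 2" and densities: "stable_densities \<alpha> \<eta>"
begin

text \<open>The cut-off discards the unspecified values of \<open>\<eta> t\<close> off the positive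
  half-line, so that the Laplace lemmas apply on the whole line.\<close>

definition stable_density :: "real \<Rightarrow> real \<Rightarrow> real" where
  "stable_density t u = indicator {0<..} u * \<eta> t u"

lemma integrable_stable_density: "0 < t \<Longrightarrow> integrable lborel (stable_density t)"
  using densities by (auto simp: stable_densities_def set_integrable_def stable_density_def[abs_def])

lemma stable_density_nonpos [simp]: "u \<le> 0 \<Longrightarrow> stable_density t u = 0"
  by (simp add: stable_density_def)

lemma laplace_stable_density:
  assumes "0 < t" "0 \<le> l"
  shows "(\<integral>u. exp (- (l * u)) * stable_density t u \<partial>lborel) = exp (- (t * l powr (\<alpha> / 2)))"
proof -
  have "(LBINT u:{0<..}. exp (- l * u) * \<eta> t u) = exp (- t * l powr (\<alpha> / 2))"
    using densities assms by (simp add: stable_densities_def)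
  then show ?thesis
    by (simp add: set_lebesgue_integral_def stable_density_def mult.left_commute)
qed

text \<open>Positivity is not part of \<open>stable_densities\<close>; it follows from complete
  monotonicity of the transform.\<close>

lemma stable_density_nonneg_AE: "AE u in lborel. 0 \<le> stable_density 1 u"
proof (rule laplace_nonneg_AE)
  show "0 \<le> (\<Sum>j\<le>m. (- 1) ^ j * real (m choose j) *
      (\<integral>u. exp (- (real (Suc k + j) * u)) * stable_density 1 u \<partial>lborel))" for k m
  proof -
    have "(\<integral>u. exp (- (real (Suc k + j) * u)) * stable_density 1 u \<partial>lborel) =
        exp (- ((real (Suc k) + real j) powr (\<alpha> / 2)))" for j
      using laplace_stable_density[of 1 "real (Suc k + j)"] by (simp add: add_ac)
    then show ?thesis
      using exp_minus_powr_differences_nonneg[of "\<alpha> / 2" "real (Suc k)" m] \<alpha> by (simp only:)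
  qed
qed (simp_all add: integrable_stable_density)

text \<open>Both sides have transform \<open>exp (- (t * l powr (\<alpha> / 2)))\<close>, so
  uniqueness applies to their difference.\<close>

lemma stable_density_scaling_AE:
  assumes "0 < t"
  shows "AE u in lborel. stable_density t u = t powr - (2 / \<alpha>) * stable_density 1 (t powr - (2 / \<alpha>) * u)"
proof -
  define c where "c = t powr - (2 / \<alpha>)"
  have c: "0 < c" using assms by (simp add: c_def)
  have int: "integrable lborel (\<lambda>u. c * stable_density 1 (c * u))"
    using lborel_integrable_real_affine[OF integrable_stable_density[of 1], of c 0] c by simp
  have "AE u in lborel. stable_density t u - c * stable_density 1 (c * u) = 0"
  proof (rule laplace_zero_AE)
    show "stable_density t u - c * stable_density 1 (c * u) = 0" if "u \<le> 0" for u
      using that c by (simp add: mult_nonneg_nonpos)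
    fix l :: real assume l: "0 \<le> l"
    have int': "integrable lborel (\<lambda>u. exp (- (l * u)) * f u)"
      if f: "integrable lborel f" "\<And>u. u \<le> 0 \<Longrightarrow> f u = 0" for f
    proof (rule Bochner_Integration.integrable_bound[OF f(1)])
      show "AE u in lborel. norm (exp (- (l * u)) * f u) \<le> norm (f u)"
      proof (rule AE_I2)
        fix u show "norm (exp (- (l * u)) * f u) \<le> norm (f u)"
          using f(2)[of u] l by (cases "u \<le> 0") (auto simp: abs_mult intro!: mult_left_le_one_le)
      qed
    qed (use f in auto)
    \<comment> \<open>Writing everything in \<open>0 + c * u\<close> prepares the affine change of
      variables.\<close>
    have "(\<integral>u. exp (- (l * u)) * (c * stable_density 1 (c * u)) \<partial>lborel) =
        \<bar>c\<bar> * (\<integral>u. exp (- (l / c * (0 + c * u))) * stable_density 1 (0 + c * u) \<partial>lborel)"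
      using c by simp (simp flip: integral_mult_right_zero add: mult_ac)
    also have "\<dots> = (\<integral>u. exp (- (l / c * u)) * stable_density 1 u \<partial>lborel)"
      using lborel_integral_real_affine[of c "\<lambda>u. exp (- (l / c * u)) * stable_density 1 u" 0] c by simp
    also have "\<dots> = exp (- (1 * (l / c) powr (\<alpha> / 2)))"
      using l c by (intro laplace_stable_density) auto
    also have "1 * (l / c) powr (\<alpha> / 2) = t * l powr (\<alpha> / 2)"
    proof -
      have "- (2 / \<alpha>) * (\<alpha> / 2) = - 1" using \<alpha> by simp
      then have "c powr (\<alpha> / 2) = 1 / t"
        unfolding c_def powr_powr using assms by (simp add: powr_minus_divide)
      then show ?thesis using l c by (simp add: powr_divide)
    qed
    also have "exp (- \<dots>) = (\<integral>u. exp (- (l * u)) * stable_density t u \<partial>lborel)"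
      using laplace_stable_density[OF assms l] by simp
    finally show "(\<integral>u. exp (- (l * u)) * (stable_density t u - c * stable_density 1 (c * u)) \<partial>lborel) = 0"
      using int'[OF integrable_stable_density[OF assms]] int'[OF int] c
      by (simp add: right_diff_distrib mult_nonneg_nonpos)
  qed (use int integrable_stable_density[OF assms] in auto)
  then show ?thesis unfolding c_def by eventually_elim simp
qed

definition law :: "real measure" where
  "law = density lborel (\<lambda>u. ennreal (stable_density 1 u))"

lemma borel_measurable_stable_density [measurable]: "stable_density 1 \<in> borel_measurable borel"
  using integrable_stable_density[of 1] by simp

lemma integral_law:
  assumes "f \<in> borel_measurable borel"
  shows "(\<integral>u. f u \<partial>law) = (\<integral>u. f u * stable_density 1 u \<partial>lborel)"
  using assms stable_density_nonneg_AE unfolding law_def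
  by (subst integral_density) (auto simp: mult.commute)

sublocale stable_law law "\<alpha> / 2"
proof (intro stable_law.intro prob_spaceI stable_law_axioms.intro)
  have "emeasure law (space law) = (\<integral>\<^sup>+u. ennreal (stable_density 1 u) \<partial>lborel)"
    by (simp add: law_def emeasure_density)
  also have "\<dots> = ennreal (\<integral>u. stable_density 1 u \<partial>lborel)"
    by (intro nn_integral_eq_integral integrable_stable_density stable_density_nonneg_AE) simp
  \<comment> \<open>Total mass is the transform at \<open>l = 0\<close>, where
    \<open>0 powr (\<alpha> / 2) = 0\<close>.\<close>
  also have "(\<integral>u. stable_density 1 u \<partial>lborel) = 1"
    using laplace_stable_density[of 1 0] by simp
  finally show "emeasure law (space law) = 1" by simp
  show "0 < \<alpha> / 2" "\<alpha> / 2 < 1" using \<alpha> by auto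
  show "sets law = sets borel" by (simp add: law_def)
  have "AE u in lborel. 0 < ennreal (stable_density 1 u) \<longrightarrow> 0 < u"
    by (rule AE_I2) (auto simp: stable_density_def split: split_indicator_asm)
  then show "AE u in law. 0 < u"
    unfolding law_def by (subst AE_density) auto
  show "(\<integral>u. exp (- (l * u)) \<partial>law) = exp (- (l powr (\<alpha> / 2)))" if "0 \<le> l" for l
    using laplace_stable_density[of 1 l] that by (simp add: integral_law)
qed

text \<open>Absence of atoms disposes of the boundary values excluded in
  \<open>heat_mass_annulus_tendsto\<close>.\<close>

lemma law_neq_AE: "AE u in law. u \<noteq> c"
  unfolding law_def using AE_lborel_singleton[of c]
  by (subst AE_density) (auto elim!: eventually_mono)

lemma integral_density_scaling:
  assumes t: "0 < t" and [measurable]: "f \<in> borel_measurable borel"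
  shows "(\<integral>u. f u * stable_density t u \<partial>lborel) = (\<integral>u. f (t powr (2 / \<alpha>) * u) \<partial>law)"
proof -
  define c where "c = t powr - (2 / \<alpha>)"
  have c: "0 < c" "1 / c = t powr (2 / \<alpha>)"
    using t by (simp_all add: c_def powr_minus divide_inverse)
  have [measurable]: "stable_density t \<in> borel_measurable borel"
    using integrable_stable_density[OF t] by simp
  have "(\<integral>u. f u * stable_density t u \<partial>lborel) = (\<integral>u. f u * (c * stable_density 1 (c * u)) \<partial>lborel)"
    using stable_density_scaling_AE[OF t] unfolding c_def[symmetric]
    by (intro integral_cong_AE) (auto elim!: eventually_mono)
  also have "\<dots> = \<bar>c\<bar> * (\<integral>u. f (1 / c * (0 + c * u)) * stable_density 1 (0 + c * u) \<partial>lborel)"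
    using c(1) by simp (simp flip: integral_mult_right_zero add: mult_ac)
  also have "\<dots> = (\<integral>u. f (1 / c * u) * stable_density 1 u \<partial>lborel)"
    using lborel_integral_real_affine[of c "\<lambda>u. f (1 / c * u) * stable_density 1 u" 0] c by simp
  also have "\<dots> = (\<integral>u. f (t powr (2 / \<alpha>) * u) \<partial>law)"
    unfolding c(2) by (subst integral_law) auto
  finally show ?thesis .
qed

end

section \<open>Limiting mass of the critical region\<close>

locale stable_tree = rooted_tree q adj x0 + stable_family \<alpha> \<eta>
  for q :: nat and adj :: "'a \<Rightarrow> 'a \<Rightarrow> bool" and x0 :: 'a
    and \<alpha> :: real and \<eta> :: "real \<Rightarrow> real \<Rightarrow> real"
begin

text \<open>Subordination: the stable mass is the heat mass at the random time
  \<open>t powr (2 / \<alpha>) * u\<close>, with \<open>u\<close> drawn from the fixed law.\<close>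

lemma sum_stable_kernel:
  assumes t: "0 < t" and F: "finite F"
  shows "(\<Sum>x\<in>F. stable_kernel q adj x0 \<eta> t x) = (\<integral>u. heat_mass (t powr (2 / \<alpha>) * u) F \<partial>law)"
proof -
  have [measurable]: "stable_density t \<in> borel_measurable borel"
    using integrable_stable_density[OF t] by simp
  have kernel: "stable_kernel q adj x0 \<eta> t x = (\<integral>u. heat_mass u {x} * stable_density t u \<partial>lborel)" for x
    using sum_heat_kernel[of "{x}"]
    by (simp add: stable_kernel_def set_lebesgue_integral_def stable_density_def mult_ac)
  have int: "integrable lborel (\<lambda>u. heat_mass u {x} * stable_density t u)" for x
  proof (rule Bochner_Integration.integrable_bound[OF integrable_stable_density[OF t]])
    show "AE u in lborel. norm (heat_mass u {x} * stable_density t u) \<le> norm (stable_density t u)"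
    proof (rule AE_I2)
      \<comment> \<open>The bounds on heat mass are available for \<open>u \<ge> 0\<close>; on the
        rest of the line the density vanishes.\<close>
      fix u show "norm (heat_mass u {x} * stable_density t u) \<le> norm (stable_density t u)"
        using heat_mass_nonneg[of u "{x}"] heat_mass_le_1[of u "{x}"]
        by (cases "u \<le> 0") (auto simp: abs_mult intro!: mult_left_le_one_le)
    qed
  qed measurable
  have "(\<Sum>x\<in>F. stable_kernel q adj x0 \<eta> t x) =
      (\<integral>u. (\<Sum>x\<in>F. heat_mass u {x} * stable_density t u) \<partial>lborel)"
    using int by (simp add: kernel Bochner_Integration.integral_sum)
  also have "\<dots> = (\<integral>u. heat_mass u F * stable_density t u \<partial>lborel)"
    using sum_heat_kernel[OF F] sum_heat_kernel[of "{_}"] by (simp flip: sum_distrib_right)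
  also have "\<dots> = (\<integral>u. heat_mass (t powr (2 / \<alpha>) * u) F \<partial>law)"
    by (rule integral_density_scaling[OF t]) measurable
  finally show ?thesis .
qed

lemma critical_region_eq: "critical_region adj x0 \<alpha> a b t = annulus a b (t powr (2 / \<alpha>))"
  by (simp add: critical_region_def annulus_def)

lemma critical_mass_tendsto:
  "((\<lambda>t. \<Sum>x\<in>critical_region adj x0 \<alpha> a b t. stable_kernel q adj x0 \<eta> t x)
    \<longlongrightarrow> prob {a / speed<..<b / speed}) at_top"
proof -
  have lim: "((\<lambda>s. \<integral>v. heat_mass (s * v) (annulus a b s) \<partial>law)
      \<longlongrightarrow> (\<integral>v. indicator {a / speed<..<b / speed} v \<partial>law)) at_top"
  proof (rule integral_dominated_convergence_at_top[where w="\<lambda>_. 1"])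
    show "\<forall>\<^sub>F s in at_top. AE v in law. norm (heat_mass (s * v) (annulus a b s)) \<le> 1"
    proof (rule eventually_at_top_linorderI)
      fix s :: real assume s: "0 \<le> s"
      show "AE v in law. norm (heat_mass (s * v) (annulus a b s)) \<le> 1"
        using pos_AE by eventually_elim (use s heat_mass_nonneg heat_mass_le_1 in auto)
    qed
    show "AE v in law. ((\<lambda>s. heat_mass (s * v) (annulus a b s))
        \<longlongrightarrow> indicator {a / speed<..<b / speed} v) at_top"
      using pos_AE law_neq_AE[of "a / speed"] law_neq_AE[of "b / speed"]
    proof eventually_elim
      case (elim v)
      have "indicator {a<..<b} (speed * v) = (indicator {a / speed<..<b / speed} v :: real)"
        using speed_pos by (auto simp: indicator_def field_simps)
      moreover have "speed * v \<noteq> a" "speed * v \<noteq> b" using elim speed_pos by (auto simp: field_simps)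
      ultimately show ?case using heat_mass_annulus_tendsto[OF elim(1), of a b] by simp
    qed
  qed (auto simp: sets_M)
  have "filterlim (\<lambda>t. exp (2 / \<alpha> * ln t)) at_top at_top"
    using \<alpha> by (intro filterlim_compose[OF exp_at_top]
        filterlim_tendsto_pos_mult_at_top[OF tendsto_const _ ln_at_top]) auto
  moreover have "\<forall>\<^sub>F t in at_top. exp (2 / \<alpha> * ln t) = t powr (2 / \<alpha>)"
    using eventually_gt_at_top[of 0] by eventually_elim (simp add: powr_def)
  ultimately have "filterlim (\<lambda>t. t powr (2 / \<alpha>)) at_top at_top"
    by (rule filterlim_cong[OF refl refl, THEN iffD1, rotated])
  from filterlim_compose[OF lim this]
  have "((\<lambda>t. \<integral>v. heat_mass (t powr (2 / \<alpha>) * v) (annulus a b (t powr (2 / \<alpha>))) \<partial>law)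
      \<longlongrightarrow> prob {a / speed<..<b / speed}) at_top"
    by (simp add: sets_M)
  moreover have "\<forall>\<^sub>F t in at_top. (\<integral>v. heat_mass (t powr (2 / \<alpha>) * v) (annulus a b (t powr (2 / \<alpha>))) \<partial>law) =
      (\<Sum>x\<in>critical_region adj x0 \<alpha> a b t. stable_kernel q adj x0 \<eta> t x)"
    using eventually_gt_at_top[of 0]
    by eventually_elim (simp add: critical_region_eq sum_stable_kernel finite_annulus)
  ultimately show ?thesis by (rule Lim_transform_eventually)
qed

lemma mass_boundsI:
  assumes "0 < c1" "c1 < prob {a / speed<..<b / speed}" "prob {a / speed<..<b / speed} < c2" "c2 < 1"
  shows "mass_bounds q adj x0 \<alpha> \<eta> a b c1 c2"
  unfolding mass_bounds_def
  using order_tendstoD(1)[OF critical_mass_tendsto assms(2)]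
    order_tendstoD(2)[OF critical_mass_tendsto assms(3)]
  by eventually_elim (use assms in simp)

end

theorem theorem3p2:
  fixes q :: nat and adj :: "'a \<Rightarrow> 'a \<Rightarrow> bool" and x0 :: 'a
    and \<alpha> :: real and \<eta> :: "real \<Rightarrow> real \<Rightarrow> real"
  assumes "q \<ge> 2"
    and "homogeneous_tree q adj"
    and "0 < \<alpha>" and "\<alpha> < 2"
    and "stable_densities \<alpha> \<eta>"
  shows "(\<forall>A\<^sub>1 A\<^sub>2. 0 < A\<^sub>1 \<and> A\<^sub>1 < A\<^sub>2 \<longrightarrow>
            (\<exists>c\<^sub>1 c\<^sub>2. mass_bounds q adj x0 \<alpha> \<eta> A\<^sub>1 A\<^sub>2 c\<^sub>1 c\<^sub>2)) \<and>
         (\<forall>c\<^sub>1. 0 < c\<^sub>1 \<and> c\<^sub>1 < 1 \<longrightarrow>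
            (\<exists>A\<^sub>1 A\<^sub>2. 0 < A\<^sub>1 \<and> A\<^sub>1 < A\<^sub>2 \<and>
               (\<exists>c\<^sub>2. mass_bounds q adj x0 \<alpha> \<eta> A\<^sub>1 A\<^sub>2 c\<^sub>1 c\<^sub>2))) \<and>
         (\<forall>c\<^sub>2. 0 < c\<^sub>2 \<and> c\<^sub>2 < 1 \<longrightarrow>
            (\<exists>A\<^sub>1 A\<^sub>2. 0 < A\<^sub>1 \<and> A\<^sub>1 < A\<^sub>2 \<and>
               (\<exists>c\<^sub>1. mass_bounds q adj x0 \<alpha> \<eta> A\<^sub>1 A\<^sub>2 c\<^sub>1 c\<^sub>2)))"
proof -
  interpret stable_tree q adj x0 \<alpha> \<eta>
    by unfold_locales (fact assms)+
  define L where "L a b = prob {a / speed<..<b / speed}" for a b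
  have L: "0 < L a b" "L a b < 1" if "0 < a" "a < b" for a b
    using that speed_pos prob_interval_pos[of "a / speed" "b / speed"]
      prob_interval_lt_1[of "a / speed" "b / speed"]
    by (auto simp: L_def divide_strict_right_mono)
  \<comment> \<open>Intervals found for the law become radii of the region after multiplication by
    the speed.\<close>
  have rescale: "prob {a<..<b} = L (speed * a) (speed * b)" for a b
    using speed_pos by (simp add: L_def)
  have bounds: "mass_bounds q adj x0 \<alpha> \<eta> a b c1 c2" if "0 < c1" "c1 < L a b" "L a b < c2" "c2 < 1"
    for a b c1 c2
    using that unfolding L_def by (rule mass_boundsI)
  show ?thesis
  proof (intro conjI allI impI)
    fix a b :: real assume "0 < a \<and> a < b"
    then have "0 < L a b" "L a b < 1" using L by auto
    \<comment> \<open>The constants are the midpoints between the limit and \<open>0\<close>, and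
      between the limit and \<open>1\<close>.\<close>
    then have "mass_bounds q adj x0 \<alpha> \<eta> a b (L a b / 2) ((1 + L a b) / 2)" by (intro bounds) auto
    then show "\<exists>c1 c2. mass_bounds q adj x0 \<alpha> \<eta> a b c1 c2" by blast
  next
    fix c1 :: real assume c: "0 < c1 \<and> c1 < 1"
    then obtain a b where "0 < a" "a < b" "c1 < prob {a<..<b}"
      using exists_interval_prob_gt by blast
    then have ab: "0 < speed * a" "speed * a < speed * b" "c1 < L (speed * a) (speed * b)"
      using speed_pos rescale by auto
    have "mass_bounds q adj x0 \<alpha> \<eta> (speed * a) (speed * b) c1 ((1 + L (speed * a) (speed * b)) / 2)"
      using c ab L[OF ab(1,2)] by (intro bounds) auto
    with ab show "\<exists>A1 A2. 0 < A1 \<and> A1 < A2 \<and> (\<exists>c2. mass_bounds q adj x0 \<alpha> \<eta> A1 A2 c1 c2)" by blast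
  next
    fix c2 :: real assume c: "0 < c2 \<and> c2 < 1"
    then obtain a b where "0 < a" "a < b" "prob {a<..<b} < c2"
      using exists_interval_prob_lt by blast
    then have ab: "0 < speed * a" "speed * a < speed * b" "L (speed * a) (speed * b) < c2"
      using speed_pos rescale by auto
    have "mass_bounds q adj x0 \<alpha> \<eta> (speed * a) (speed * b) (L (speed * a) (speed * b) / 2) c2"
      using c ab L[OF ab(1,2)] by (intro bounds) auto
    with ab show "\<exists>A1 A2. 0 < A1 \<and> A1 < A2 \<and> (\<exists>c1. mass_bounds q adj x0 \<alpha> \<eta> A1 A2 c1 c2)" by blast
  qed
qed

end
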